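(* There is a universal constant $C>0$ such that the following holds for all integers $n,d\ge1$, all $\alpha\in(0,e^{-1})$, $\beta\in(0,1-\alpha)$, and all $\epsilon_n$ with $$\epsilon_n\ \ge\ \frac{C}{\beta}\sqrt{\log\Big(\frac1\alpha\Big)}\cdot\max\left\{\frac{d^{1/2}}{n^{3/4}},\ \frac{d^{1/4}}{n^{1/2}}\right\}.$$ For testing $\mathcal{P}_0=\{(p_Y,p_Z):p_Y=p_Z\}$ against $\mathcal{P}_1=\{(p_Y,p_Z):\|p_Y-p_Z\|_1\ge\epsilon_n\}$, where $p_Y,p_Z$ are probability distributions on $\{1,\dots,d\}$, under the Poisson sampling model described in the context, the permutation test based on the centered chi-square statistic $T_{\chi^2}$ satisfies $$\sup_{P\in\mathcal{P}_0}\mathbb{P}_P(T_{\chi^2}>c_{1-\alpha,n})\le\alpha\quad\text{and}\quad\sup_{P\in\mathcal{P}_1}\mathbb{P}_P(T_{\chi^2}\le c_{1-\alpha,n})\le\beta .$$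
   Context: Poisson sampling: for each $k\in\{1,\dots,d\}$ one observes $Y_{1,k},\dots,Y_{n,k}$ i.i.d. $\mathrm{Poisson}(p_Y(k))$ and $Z_{1,k},\dots,Z_{n,k}$ i.i.d. $\mathrm{Poisson}(p_Z(k))$, all mutually independent (across $k$ and across the two samples). Let $V_k:=\sum_{i=1}^nY_{i,k}$, $W_k:=\sum_{i=1}^nZ_{i,k}$ and $$T_{\chi^2}:=\sum_{k=1}^d\frac{(V_k-W_k)^2-V_k-W_k}{V_k+W_k}\,\mathbb{1}(V_k+W_k>0).$$ Permutation critical value: let $(X_{1,k},\dots,X_{2n,k}):=(Y_{1,k},\dots,Y_{n,k},Z_{1,k},\dots,Z_{n,k})$ and, for a permutation $\pi$ of $\{1,\dots,2n\}$ (the same for every $k$), $$T^\pi_{\chi^2}:=\sum_{k=1}^d\frac{\left(\sum_{i=1}^nX_{\pi_i,k}-\sum_{i=1}^nX_{\pi_{i+n},k}\right)^2-V_k-W_k}{V_k+W_k}\,\mathbb{1}(V_k+W_k>0).$$ Then $c_{1-\alpha,n}:=\inf\{t:\frac1{(2n)!}\sum_\pi\mathbb{1}(T^\pi_{\chi^2}\le t)\ge1-\alpha\}$. *)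

theory Defs
  imports "HOL-Probability.Probability" "HOL-Combinatorics.Permutations"
begin

text \<open>
  The library's \<^term>\<open>poisson_pmf r\<close> is specified only for \<open>r > 0\<close>. Cell probabilities may
  vanish, so the point mass at \<open>0\<close> is used for \<open>r = 0\<close>.
\<close>
definition poisson :: "real \<Rightarrow> nat pmf" where
  "poisson r = (if r > 0 then poisson_pmf r else return_pmf 0)"

text \<open>
  A sample is a function of the pair (observation index, category). The distributions
  on \<open>{1..d}\<close> are probability mass functions on \<open>nat\<close> supported in \<open>{1..d}\<close>.
\<close>
type_synonym sample = "nat \<times> nat \<Rightarrow> nat"

definition distributions :: "nat \<Rightarrow> nat pmf set" where
  "distributions d = {p. set_pmf p \<subseteq> {1..d}}"

definition l1_distance :: "nat \<Rightarrow> nat pmf \<Rightarrow> nat pmf \<Rightarrow> real" where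
  "l1_distance d p q = (\<Sum>k=1..d. \<bar>pmf p k - pmf q k\<bar>)"

definition null_class :: "nat \<Rightarrow> (nat pmf \<times> nat pmf) set" where
  "null_class d = {(pY, pZ). pY \<in> distributions d \<and> pZ \<in> distributions d \<and> pY = pZ}"

definition alt_class :: "nat \<Rightarrow> real \<Rightarrow> (nat pmf \<times> nat pmf) set" where
  "alt_class d \<epsilon> =
     {(pY, pZ). pY \<in> distributions d \<and> pZ \<in> distributions d \<and> l1_distance d pY pZ \<ge> \<epsilon>}"

definition poisson_sample :: "nat \<Rightarrow> nat \<Rightarrow> nat pmf \<Rightarrow> sample pmf" where
  "poisson_sample n d p = Pi_pmf ({1..n} \<times> {1..d}) 0 (\<lambda>(i, k). poisson (pmf p k))"

text \<open>The joint law of \<open>(Y, Z)\<close>, all \<open>2 * n * d\<close> entries being mutually independent.\<close>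
definition poisson_model :: "nat \<Rightarrow> nat \<Rightarrow> nat pmf \<times> nat pmf \<Rightarrow> (sample \<times> sample) pmf" where
  "poisson_model n d P = pair_pmf (poisson_sample n d (fst P)) (poisson_sample n d (snd P))"

definition cell_count :: "nat \<Rightarrow> sample \<Rightarrow> nat \<Rightarrow> real" where
  "cell_count n S k = (\<Sum>i=1..n. real (S (i, k)))"

definition chi2_stat :: "nat \<Rightarrow> nat \<Rightarrow> sample \<Rightarrow> sample \<Rightarrow> real" where
  "chi2_stat n d Y Z =
     (\<Sum>k=1..d. let V = cell_count n Y k; W = cell_count n Z k in
        ((V - W)\<^sup>2 - V - W) / (V + W) * of_bool (V + W > 0))"

definition pooled :: "nat \<Rightarrow> sample \<Rightarrow> sample \<Rightarrow> sample" where
  "pooled n Y Z = (\<lambda>(i, k). if i \<le> n then Y (i, k) else Z (i - n, k))"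

definition perm_chi2_stat ::
    "nat \<Rightarrow> nat \<Rightarrow> sample \<Rightarrow> sample \<Rightarrow> (nat \<Rightarrow> nat) \<Rightarrow> real" where
  "perm_chi2_stat n d Y Z \<pi> =
     (\<Sum>k=1..d. let V = cell_count n Y k; W = cell_count n Z k; X = pooled n Y Z in
        (((\<Sum>i=1..n. real (X (\<pi> i, k))) - (\<Sum>i=1..n. real (X (\<pi> (i + n), k))))\<^sup>2 - V - W)
          / (V + W) * of_bool (V + W > 0))"

definition perm_critical_value ::
    "nat \<Rightarrow> nat \<Rightarrow> real \<Rightarrow> sample \<Rightarrow> sample \<Rightarrow> real" where
  "perm_critical_value n d \<alpha> Y Z =
     Inf {t. 1 / fact (2 * n) *
               (\<Sum>\<pi> | \<pi> permutes {1..2 * n}. of_bool (perm_chi2_stat n d Y Z \<pi> \<le> t))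
             \<ge> 1 - \<alpha>}"

end

(*
  Type I error: under the null hypothesis the pooled field of counts is exchangeable in its rows, so
  the permutation test has level alpha.

  Type II error: compose a uniform permutation with random swaps of i and i + n. Given the
  permutation, the statistic is at most D + Q, where D = sum_k sum_i X_ik (X_ik - 1) / N_k (with N_k
  the total count of category k) and Q is a Rademacher chaos of order two, whose coefficients have
  squared Frobenius norm at most 4 S, with S = sum_(i ~= j) (sum_k X_ik X_jk / N_k)^2. An exponential
  moment bound for Q gives the critical value <= D + 8 log(1/alpha) sqrt(4 S), with only a logarithm
  of 1/alpha. All moments follow from the Mecke identity E[X_x f(X)] = a_x E[f(X + e_x)] for
  independent Poisson variables: E D <= 2, E S <= 28 min(d, n), and the observed statistic has mean
  mu >= n^2 |p_Y - p_Z|_1^2 / (2 (n + d)) and variance at most 8 mu + 4 min(d, n). Markov's and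
  Chebyshev's inequalities then yield the power, with C = 100.
*)

theory Submission
  imports Defs
begin

text \<open>The critical value is random, and a second-moment bound over permutations would make it
  grow like a power of \<open>1 / \<alpha>\<close>. Exponential moments keep the growth logarithmic;
  since the mean of the statistic is quadratic in the separation, the logarithm enters the condition
  on \<epsilon> under a square root. The terms at a uniform permutation are not independent, which
  is why swaps are inserted: they preserve the uniform law and supply independent signs for fixed
  data. On the moment side the obstacle is the random denominator N_k, which depends on every
  numerator. A Mecke step removes a count from the numerator and raises N_k by one, so that only
  inverse moments remain; read backwards, the same identity bounds them. The order min(d, n) arises
  because a category contributes, up to constants, min(1, lam_k), where the means lam_k sum to 2 n.
  The mean therefore has to reach the order of log(1/\<alpha>) sqrt(min(d, n)) / \<beta>^2. Solving
  for the distance gives one entry of the maximum for d \<le> n and the other for d > n.\<close>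

section \<open>Rademacher chaos of order two\<close>

text \<open>A sign vector is encoded as the set of indices that carry -1. Averages over uniform
  signs become finite sums over \<open>Pow S\<close>, and the same set later selects the pairs of
  rows to exchange.\<close>

definition rsign :: "'a set \<Rightarrow> 'a \<Rightarrow> real" where
  "rsign I i = (if i \<in> I then -1 else 1)"

definition off_diag :: "'a set \<Rightarrow> ('a \<Rightarrow> 'a \<Rightarrow> real) \<Rightarrow> real" where
  "off_diag S f = (\<Sum>i\<in>S. \<Sum>j\<in>S - {i}. f i j)"

lemma rsign_sq [simp]: "rsign I i * rsign I i = 1" "(rsign I i)\<^sup>2 = 1"
  by (auto simp: rsign_def)

lemma off_diag_eq:
  assumes "finite S"
  shows "off_diag S f = (\<Sum>i\<in>S. \<Sum>j\<in>S. f i j) - (\<Sum>i\<in>S. f i i)"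
  using assms unfolding off_diag_def sum_subtractf[symmetric]
  by (intro sum.cong refl) (simp add: sum_diff1)

lemma off_diag_add: "off_diag S (\<lambda>i j. f i j + g i j) = off_diag S f + off_diag S g"
  by (simp add: off_diag_def sum.distrib)

lemma off_diag_cmult: "off_diag S (\<lambda>i j. c * f i j) = c * off_diag S f"
  by (simp add: off_diag_def sum_distrib_left)

lemma off_diag_mono: "(\<And>i j. i \<in> S \<Longrightarrow> j \<in> S \<Longrightarrow> i \<noteq> j \<Longrightarrow> f i j \<le> g i j) \<Longrightarrow> off_diag S f \<le> off_diag S g"
  unfolding off_diag_def by (intro sum_mono) auto

lemma off_diag_nonneg: "(\<And>i j. i \<in> S \<Longrightarrow> j \<in> S \<Longrightarrow> i \<noteq> j \<Longrightarrow> 0 \<le> f i j) \<Longrightarrow> 0 \<le> off_diag S f"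
  unfolding off_diag_def by (intro sum_nonneg) auto

lemma off_diag_insert:
  assumes "finite S" "s \<notin> S" "\<And>i. i \<in> S \<Longrightarrow> f i s = f s i"
  shows "off_diag (insert s S) f = off_diag S f + 2 * (\<Sum>j\<in>S. f s j)"
  using assms by (simp add: off_diag_eq sum.distrib)

lemma off_diag_Cauchy_Schwarz:
  assumes "finite S"
  shows "(off_diag S (\<lambda>i j. f i j * g i j))\<^sup>2
    \<le> off_diag S (\<lambda>i j. (f i j)\<^sup>2) * off_diag S (\<lambda>i j. (g i j)\<^sup>2)"
  using Cauchy_Schwarz_ineq_sum[of "\<lambda>(i,j). f i j" "\<lambda>(i,j). g i j" "SIGMA i:S. S - {i}"] assms
  unfolding off_diag_def by (simp add: sum.Sigma case_prod_unfold)

text \<open>The power series compare term by term because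
  \<open>2 ^ n * fact n \<le> fact (2 * n)\<close>. This is the sub-Gaussian bound for a single
  sign.\<close>

lemma cosh_le_exp: "exp x + exp (- x) \<le> 2 * exp (x\<^sup>2 / 2)" for x :: real
proof -
  have s: "(\<lambda>n. if even n then x ^ n / fact n else 0) sums cosh x"
    using cosh_converges[of x] by (simp add: if_distrib scaleR_conv_of_real field_simps cong: if_cong)
  have e: "(\<lambda>n. (x\<^sup>2 / 2) ^ n / fact n) sums exp (x\<^sup>2 / 2)"
    using exp_converges[of "x\<^sup>2/2"] by (simp add: scaleR_conv_of_real field_simps)
  have "strict_mono (\<lambda>n::nat. 2 * n)" by (simp add: strict_mono_def)
  then have s2: "(\<lambda>n. x ^ (2*n) / fact (2*n)) sums cosh x"
    using s by (subst (asm) sums_mono_reindex[symmetric, of "\<lambda>n. 2*n"]) (auto elim: evenE)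
  have f: "2 ^ n * fact n \<le> (fact (2 * n) :: real)" for n
  proof (induction n)
    case (Suc n)
    have "2 ^ Suc n * fact (Suc n) = (2 * (real n + 1)) * (2 ^ n * fact n)" by (simp add: algebra_simps)
    also have "\<dots> \<le> (2 * (real n + 1)) * fact (2 * n)" using Suc by (intro mult_left_mono) auto
    also have "\<dots> \<le> ((2 * real n + 2) * (2 * real n + 1)) * fact (2 * n)"
      by (intro mult_right_mono) (auto simp: algebra_simps)
    also have "\<dots> = fact (2 * Suc n)" by (simp add: algebra_simps)
    finally show ?case .
  qed simp
  have "cosh x \<le> exp (x\<^sup>2 / 2)"
  proof (rule sums_le[OF _ s2 e])
    fix n
    have "x ^ (2*n) / fact (2*n) \<le> x ^ (2*n) / (2 ^ n * fact n)"
      using f[of n] by (intro divide_left_mono) (auto simp: power_mult)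
    then show "x ^ (2*n) / fact (2*n) \<le> (x\<^sup>2 / 2) ^ n / fact n"
      by (simp add: power_divide power_mult)
  qed
  then show ?thesis by (simp add: cosh_def)
qed

lemma sum_Pow_insert:
  assumes "finite S" "s \<notin> S"
  shows "sum G (Pow (insert s S)) = (\<Sum>I\<in>Pow S. G I + G (insert s I))"
proof -
  have "inj_on (insert s) (Pow S)" using assms by (auto simp: inj_on_def insert_ident)
  moreover have "Pow S \<inter> insert s ` Pow S = {}" using assms by auto
  ultimately show ?thesis using assms
    by (simp add: Pow_insert sum.union_disjoint sum.reindex sum.distrib)
qed

text \<open>
  Averaging over one sign turns the coefficients \<open>A i j\<close> into \<open>A i j + 2 * a i * a j\<close>, where \<open>a\<close> is the
  removed row; the constant \<open>1 / 16\<close> makes both the hypothesis and the bound stable under this step.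
\<close>
lemma rademacher_chaos_exp:
  fixes A :: "'a \<Rightarrow> 'a \<Rightarrow> real"
  assumes "finite S" "\<And>i j. A i j = A j i" "off_diag S (\<lambda>i j. (A i j)\<^sup>2) \<le> 1 / 16"
  shows "(\<Sum>I\<in>Pow S. exp (off_diag S (\<lambda>i j. A i j * rsign I i * rsign I j)))
    \<le> 2 ^ card S * exp (3 * off_diag S (\<lambda>i j. (A i j)\<^sup>2))"
  using assms
proof (induction S arbitrary: A rule: finite_induct)
  case empty
  then show ?case by (simp add: off_diag_def)
next
  case (insert s S A)
  define a where "a = A s"
  define A' where "A' i j = A i j + 2 * (a i * a j)" for i j
  define f where "f = (\<Sum>j\<in>S. (a j)\<^sup>2)"
  define F0 where "F0 = off_diag S (\<lambda>i j. (A i j)\<^sup>2)"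
  define F where "F = off_diag (insert s S) (\<lambda>i j. (A i j)\<^sup>2)"
  define F' where "F' = off_diag S (\<lambda>i j. (A' i j)\<^sup>2)"
  have f0: "0 \<le> f" "0 \<le> F0" unfolding f_def F0_def by (auto intro!: sum_nonneg off_diag_nonneg)
  have F: "F = F0 + 2 * f"
    unfolding F_def F0_def f_def a_def
    by (subst off_diag_insert[OF insert.hyps]) (simp_all only: insert.prems(1)[of _ s])
  have f1: "f \<le> 1 / 32" "F0 \<le> 1 / 16" using F f0 insert.prems(2) unfolding F_def[symmetric] by linarith+
  have aa: "off_diag S (\<lambda>i j. (a i * a j)\<^sup>2) \<le> f\<^sup>2"
    using insert.hyps
    by (simp add: off_diag_eq f_def power2_eq_square[of "sum _ _"] sum_product power_mult_distrib sum_nonneg)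
  have c1: "(off_diag S (\<lambda>i j. A i j * (a i * a j)))\<^sup>2 \<le> F0 * f\<^sup>2"
    using off_diag_Cauchy_Schwarz[OF insert.hyps(1), of A "\<lambda>i j. a i * a j"]
      mult_left_mono[OF aa f0(2)] unfolding F0_def by linarith
  \<comment> \<open>The threshold \<open>1 / 16\<close> acts here: the remaining coefficients have
    Frobenius norm at most 1/4, so Cauchy-Schwarz bounds the cross term by
    \<open>f / 4\<close>.\<close>
  have c2: "F0 * f\<^sup>2 \<le> (f / 4)\<^sup>2"
    using f1 mult_right_mono[of F0 "1/16" "f\<^sup>2"] by (simp add: power_divide)
  have cross: "off_diag S (\<lambda>i j. A i j * (a i * a j)) \<le> f / 4"
    by (rule power2_le_imp_le[OF order.trans[OF c1 c2]]) (use f0 in simp)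
  have "F' = F0 + 4 * off_diag S (\<lambda>i j. A i j * (a i * a j)) + 4 * off_diag S (\<lambda>i j. (a i * a j)\<^sup>2)"
  proof -
    have "F' = off_diag S (\<lambda>i j. (A i j)\<^sup>2 + 4 * (A i j * (a i * a j)) + 4 * (a i * a j)\<^sup>2)"
      unfolding F'_def A'_def by (simp add: power2_eq_square algebra_simps)
    then show ?thesis by (simp only: off_diag_add off_diag_cmult F0_def)
  qed
  also have "\<dots> \<le> F0 + f + 4 * f\<^sup>2" using cross aa by simp
  also have "4 * f\<^sup>2 \<le> f / 8" using f0 f1 mult_right_mono[of f "1/32" f] by (simp add: power2_eq_square)
  finally have F': "F' \<le> F0 + 9 / 8 * f" by simp
  then have F'le: "F' \<le> 1 / 16" using F f0 insert.prems(2) unfolding F_def[symmetric] by linarith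
  have split: "off_diag (insert s S) (\<lambda>i j. A i j * rsign I i * rsign I j)
     = off_diag S (\<lambda>i j. A i j * rsign I i * rsign I j) + 2 * rsign I s * (\<Sum>j\<in>S. a j * rsign I j)" for I
  proof -
    have "off_diag (insert s S) (\<lambda>i j. A i j * rsign I i * rsign I j)
     = off_diag S (\<lambda>i j. A i j * rsign I i * rsign I j) + 2 * (\<Sum>j\<in>S. A s j * rsign I s * rsign I j)"
      by (rule off_diag_insert[OF insert.hyps]) (subst insert.prems(1), simp only: mult_ac)
    also have "(\<Sum>j\<in>S. A s j * rsign I s * rsign I j) = rsign I s * (\<Sum>j\<in>S. a j * rsign I j)"
      by (simp add: a_def sum_distrib_left mult_ac)
    finally show ?thesis by simp
  qed
  have cong: "off_diag S (\<lambda>i j. A i j * rsign (insert s I) i * rsign (insert s I) j)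
      = off_diag S (\<lambda>i j. A i j * rsign I i * rsign I j)"
    "(\<Sum>j\<in>S. a j * rsign (insert s I) j) = (\<Sum>j\<in>S. a j * rsign I j)" for I
  proof -
    have "rsign (insert s I) i = rsign I i" if "i \<in> S" for i
      using that insert.hyps by (auto simp: rsign_def)
    then show "off_diag S (\<lambda>i j. A i j * rsign (insert s I) i * rsign (insert s I) j)
      = off_diag S (\<lambda>i j. A i j * rsign I i * rsign I j)"
    "(\<Sum>j\<in>S. a j * rsign (insert s I) j) = (\<Sum>j\<in>S. a j * rsign I j)"
      unfolding off_diag_def by (auto intro!: sum.cong)
  qed
  have step: "exp (off_diag (insert s S) (\<lambda>i j. A i j * rsign I i * rsign I j))
      + exp (off_diag (insert s S) (\<lambda>i j. A i j * rsign (insert s I) i * rsign (insert s I) j))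
     \<le> 2 * exp (2 * f) * exp (off_diag S (\<lambda>i j. A' i j * rsign I i * rsign I j))"
    if "I \<in> Pow S" for I
  proof -
    define y where "y = (\<Sum>j\<in>S. a j * rsign I j)"
    define Q where "Q = off_diag S (\<lambda>i j. A i j * rsign I i * rsign I j)"
    have s: "rsign I s = 1" "rsign (insert s I) s = -1" using that insert.hyps by (auto simp: rsign_def)
    have "exp (off_diag (insert s S) (\<lambda>i j. A i j * rsign I i * rsign I j))
      + exp (off_diag (insert s S) (\<lambda>i j. A i j * rsign (insert s I) i * rsign (insert s I) j))
      = exp Q * (exp (2 * y) + exp (- (2 * y)))"
      unfolding split cong s y_def[symmetric] Q_def[symmetric]
      by (simp add: distrib_left flip: exp_add)
    also have "\<dots> \<le> exp Q * (2 * exp ((2 * y)\<^sup>2 / 2))"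
      by (intro mult_left_mono cosh_le_exp) auto
    also have "\<dots> = 2 * exp (Q + 2 * y\<^sup>2)" by (simp add: exp_add power_mult_distrib)
    \<comment> \<open>Signs square to 1, so the diagonal of the square is the constant
      \<open>f\<close>; what is left is the rank-one update that leads from \<open>A\<close> to
      \<open>A'\<close>.\<close>
    also have "y\<^sup>2 = f + off_diag S (\<lambda>i j. (a i * a j) * rsign I i * rsign I j)"
    proof -
      have "a i * a i * rsign I i * rsign I i = (a i)\<^sup>2" for i
        by (simp add: mult.assoc power2_eq_square)
      then have "off_diag S (\<lambda>i j. (a i * a j) * rsign I i * rsign I j)
         = (\<Sum>i\<in>S. \<Sum>j\<in>S. (a i * a j) * rsign I i * rsign I j) - f"
        using insert.hyps by (simp add: off_diag_eq f_def)
      also have "(\<Sum>i\<in>S. \<Sum>j\<in>S. (a i * a j) * rsign I i * rsign I j) = y\<^sup>2"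
        by (simp add: y_def power2_eq_square sum_product mult_ac)
      finally show ?thesis by simp
    qed
    also have "Q + 2 * (f + off_diag S (\<lambda>i j. (a i * a j) * rsign I i * rsign I j))
       = 2 * f + off_diag S (\<lambda>i j. A' i j * rsign I i * rsign I j)"
    proof -
      have "off_diag S (\<lambda>i j. A' i j * rsign I i * rsign I j)
        = off_diag S (\<lambda>i j. A i j * rsign I i * rsign I j + 2 * ((a i * a j) * rsign I i * rsign I j))"
        unfolding A'_def by (simp add: algebra_simps)
      then show ?thesis unfolding Q_def by (simp add: off_diag_add off_diag_cmult)
    qed
    finally show ?thesis by (simp add: exp_add)
  qed
  have "(\<Sum>I\<in>Pow (insert s S). exp (off_diag (insert s S) (\<lambda>i j. A i j * rsign I i * rsign I j)))
     \<le> (\<Sum>I\<in>Pow S. 2 * exp (2 * f) * exp (off_diag S (\<lambda>i j. A' i j * rsign I i * rsign I j)))"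
    unfolding sum_Pow_insert[OF insert.hyps] by (intro sum_mono step)
  also have "\<dots> = 2 * exp (2 * f) * (\<Sum>I\<in>Pow S. exp (off_diag S (\<lambda>i j. A' i j * rsign I i * rsign I j)))"
    by (simp add: sum_distrib_left)
  also have "\<dots> \<le> 2 * exp (2 * f) * (2 ^ card S * exp (3 * F'))"
    unfolding F'_def using F'le
    by (intro mult_left_mono insert.IH)
       (simp_all add: F'_def, simp only: A'_def insert.prems(1) mult.commute)
  also have "\<dots> = 2 ^ card (insert s S) * exp (2 * f + 3 * F')"
    using insert.hyps by (simp add: exp_add)
  \<comment> \<open>The removed sign costs \<open>2 * f\<close>, and \<open>3 * F'\<close> exceeds
    \<open>3 * F0\<close> by at most \<open>27 / 8 * f\<close>. Together this stays below
    \<open>6 * f\<close>, the excess of \<open>3 * F\<close> over \<open>3 * F0\<close>.\<close>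
  also have "\<dots> \<le> 2 ^ card (insert s S) * exp (3 * F)"
    using F F' f0 by (intro mult_left_mono) auto
  finally show ?case unfolding F_def .
qed

section \<open>The permutation critical value\<close>

definition col_sum :: "nat \<Rightarrow> sample \<Rightarrow> nat \<Rightarrow> real" where
  "col_sum n X k = (\<Sum>i=1..2*n. real (X (i, k)))"

text \<open>
  On the pooled sample \<open>X\<close>, with rows \<open>1..2*n\<close>. Since \<open>x / 0 = 0\<close>, the indicator of a nonempty
  category can be dropped.
\<close>
definition perm_stat :: "nat \<Rightarrow> nat \<Rightarrow> sample \<Rightarrow> (nat \<Rightarrow> nat) \<Rightarrow> real" where
  "perm_stat n d X \<pi> = (\<Sum>k=1..d.
     ((\<Sum>i=1..n. real (X (\<pi> i, k)) - real (X (\<pi> (i + n), k)))\<^sup>2 - col_sum n X k) / col_sum n X k)"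

text \<open>The numerator is the sum of the squared counts minus the column total. Written with
  \<open>x * (x - 1)\<close>, every summand is nonnegative on natural numbers and has the form that
  two Mecke steps evaluate.\<close>

definition diag_part :: "nat \<Rightarrow> nat \<Rightarrow> sample \<Rightarrow> real" where
  "diag_part n d X = (\<Sum>k=1..d. (\<Sum>i=1..2*n. real (X (i, k)) * (real (X (i, k)) - 1)) / col_sum n X k)"

definition overlap :: "nat \<Rightarrow> sample \<Rightarrow> nat \<Rightarrow> nat \<Rightarrow> nat \<Rightarrow> real" where
  "overlap n X d i j = (\<Sum>k=1..d. real (X (i, k)) * real (X (j, k)) / col_sum n X k)"

definition overlap_energy :: "nat \<Rightarrow> nat \<Rightarrow> sample \<Rightarrow> real" where
  "overlap_energy n d X = off_diag {1..2*n} (\<lambda>i j. (overlap n X d i j)\<^sup>2)"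

lemma col_sum_nonneg: "0 \<le> col_sum n X k"
  unfolding col_sum_def by (simp add: sum_nonneg)

text \<open>Realizes the signs \<open>rsign I\<close> by a permutation: composed on the right of
  \<pi>, it exchanges the two members of each pair selected by \<open>I\<close> and so flips the
  sign of their difference.\<close>

definition swap_rows :: "nat \<Rightarrow> nat set \<Rightarrow> nat \<Rightarrow> nat" where
  "swap_rows n I i = (if i \<in> {1..n} \<and> i \<in> I then i + n
     else if i \<in> {n+1..2*n} \<and> i - n \<in> I then i - n else i)"

lemma swap_rows_permutes: "swap_rows n I permutes {1..2*n}"
proof (rule bij_imp_permutes)
  show "bij_betw (swap_rows n I) {1..2*n} {1..2*n}"
    by (rule bij_betw_byWitness[where f' = "swap_rows n I"]) (auto simp: swap_rows_def)
qed (auto simp: swap_rows_def)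

lemma sum_double: "(\<Sum>i=1..2*n. f i) = (\<Sum>i=1..n. f i + f (i + n))"
  for f :: "nat \<Rightarrow> 'a::comm_monoid_add"
proof -
  have "{1..2*n} = {1..n} \<union> (\<lambda>i. i + n) ` {1..n}"
    by (auto simp: image_iff intro!: bexI[of _ "_ - n"])
  moreover have "sum f ({1..n} \<union> (\<lambda>i. i + n) ` {1..n}) = sum f {1..n} + sum f ((\<lambda>i. i + n) ` {1..n})"
    by (rule sum.union_disjoint) auto
  moreover have "sum f ((\<lambda>i. i + n) ` {1..n}) = (\<Sum>i=1..n. f (i + n))"
    by (subst sum.reindex) (auto simp: inj_on_def)
  ultimately show ?thesis by (simp only: sum.distrib)
qed

text \<open>Only the pairs \<open>(i, i + n)\<close> and \<open>(i + n, i)\<close> are missing on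
  the left, and their terms are nonnegative.\<close>

lemma off_diag_double_ge:
  assumes "\<And>i j. 0 \<le> f i j"
  shows "off_diag {1..n} (\<lambda>i j. f i j + f i (j + n) + f (i + n) j + f (i + n) (j + n)) \<le> off_diag {1..2*n::nat} f"
  (is "?L \<le> _")
proof -
  have "off_diag {1..2*n} f = (\<Sum>i=1..n. (\<Sum>j\<in>{1..n}. f i j + f i (j+n)) + (\<Sum>j\<in>{1..n}. f (i+n) j + f (i+n) (j+n)))
     - (\<Sum>i=1..n. f i i + f (i+n) (i+n))"
    by (simp only: off_diag_eq[OF finite_atLeastAtMost] sum_double)
  also have "\<dots> = ?L + (\<Sum>i=1..n. f i (i+n) + f (i+n) i)"
    by (simp add: off_diag_eq sum.distrib algebra_simps)
  also have "\<dots> \<ge> ?L" using assms by (auto intro!: sum_nonneg add_nonneg_nonneg)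
  finally show ?thesis .
qed

lemma off_diag_permute:
  assumes "\<pi> permutes S" "finite S"
  shows "off_diag S (\<lambda>i j. f (\<pi> i) (\<pi> j)) = off_diag S f"
proof -
  have "(\<Sum>i\<in>S. \<Sum>j\<in>S. f (\<pi> i) (\<pi> j)) = (\<Sum>i\<in>S. \<Sum>j\<in>S. f (\<pi> i) j)"
    using sum.permute[OF assms(1), unfolded o_def, of "f (\<pi> i)" for i] by (simp only:)
  also have "\<dots> = (\<Sum>i\<in>S. \<Sum>j\<in>S. f i j)"
    by (rule sum.permute[OF assms(1), unfolded o_def, of "\<lambda>i. \<Sum>j\<in>S. f i j", symmetric])
  finally show ?thesis
    using sum.permute[OF assms(1), unfolded o_def, of "\<lambda>i. f i i"] assms(2) by (simp add: off_diag_eq)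
qed

text \<open>A swap only flips the sign of a difference \<open>B i k\<close>, so the expanded square
  is a chaos plus a sign-free diagonal. Counts are nonnegative, hence
  \<open>(a - b)^2 \<le> a^2 + b^2\<close>, which makes the bound on the diagonal independent of
  \<pi> and \<open>I\<close>.\<close>

lemma perm_stat_swap_le:
  fixes n d X \<pi>
  defines "B \<equiv> \<lambda>i k. real (X (\<pi> i, k)) - real (X (\<pi> (i + n), k))"
  defines "M \<equiv> \<lambda>i j. \<Sum>k=1..d. B i k * B j k / col_sum n X k"
  assumes \<pi>: "\<pi> permutes {1..2*n}" and I: "I \<subseteq> {1..n}"
  shows "perm_stat n d X (\<pi> \<circ> swap_rows n I)
    \<le> diag_part n d X + off_diag {1..n} (\<lambda>i j. M i j * rsign I i * rsign I j)"
proof -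
  define N where "N k = col_sum n X k" for k
  have flip: "real (X ((\<pi> \<circ> swap_rows n I) i, k)) - real (X ((\<pi> \<circ> swap_rows n I) (i + n), k)) = rsign I i * B i k"
    if "i \<in> {1..n}" for i k
    using that I by (auto simp: swap_rows_def rsign_def B_def)
  have "perm_stat n d X (\<pi> \<circ> swap_rows n I) = (\<Sum>k=1..d. ((\<Sum>i=1..n. rsign I i * B i k)\<^sup>2 - N k) / N k)"
    unfolding perm_stat_def N_def by (intro sum.cong refl) (simp only: flip cong: sum.cong)
  \<comment> \<open>\<open>N k / N k\<close> is 0 and not 1 for an empty category, so it is carried
    along uncancelled until it recombines with the diagonal.\<close>
  also have "\<dots> = (\<Sum>k=1..d. (\<Sum>i=1..n. \<Sum>j=1..n. B i k * B j k / N k * rsign I i * rsign I j) - N k / N k)"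
    by (intro sum.cong refl)
       (simp add: power2_eq_square sum_product diff_divide_distrib sum_divide_distrib mult_ac)
  also have "\<dots> = (\<Sum>i=1..n. \<Sum>j=1..n. M i j * rsign I i * rsign I j) - (\<Sum>k=1..d. N k / N k)"
    unfolding sum_subtractf M_def sum_distrib_right N_def
    by (subst sum.swap, subst (2) sum.swap) simp
  also have "\<dots> = off_diag {1..n} (\<lambda>i j. M i j * rsign I i * rsign I j)
      + ((\<Sum>i=1..n. M i i) - (\<Sum>k=1..d. N k / N k))"
    by (simp add: off_diag_eq mult.assoc)
  also have "(\<Sum>i=1..n. M i i) - (\<Sum>k=1..d. N k / N k) = (\<Sum>k=1..d. ((\<Sum>i=1..n. (B i k)\<^sup>2) - N k) / N k)"
    unfolding M_def N_def
    by (subst sum.swap) (simp add: diff_divide_distrib sum_subtractf power2_eq_square sum_divide_distrib)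
  also have "\<dots> \<le> diag_part n d X"
    unfolding diag_part_def N_def
  proof (intro sum_mono divide_right_mono col_sum_nonneg)
    fix k
    have "(\<Sum>i=1..n. (B i k)\<^sup>2) \<le> (\<Sum>i=1..n. (real (X (\<pi> i, k)))\<^sup>2 + (real (X (\<pi> (i + n), k)))\<^sup>2)"
      unfolding B_def by (intro sum_mono) (simp add: power2_eq_square algebra_simps)
    also have "\<dots> = (\<Sum>i=1..2*n. (real (X (\<pi> i, k)))\<^sup>2)" by (simp only: sum_double)
    also have "\<dots> = (\<Sum>i=1..2*n. (real (X (i, k)))\<^sup>2)"
      by (rule sum.permute[OF \<pi>, unfolded o_def, symmetric])
    finally show "(\<Sum>i=1..n. (B i k)\<^sup>2) - col_sum n X k \<le> (\<Sum>i=1..2*n. real (X (i, k)) * (real (X (i, k)) - 1))"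
      unfolding col_sum_def by (simp add: power2_eq_square right_diff_distrib sum_subtractf)
  qed
  finally show ?thesis by linarith
qed

text \<open>Each \<open>M i j\<close> is a signed sum of four overlaps. Squaring four terms costs
  the factor 4, and permuting the rows leaves the off-diagonal total unchanged.\<close>

lemma diff_overlap_energy_le:
  fixes n d X \<pi>
  defines "B \<equiv> \<lambda>i k. real (X (\<pi> i, k)) - real (X (\<pi> (i + n), k))"
  defines "M \<equiv> \<lambda>i j. \<Sum>k=1..d. B i k * B j k / col_sum n X k"
  assumes \<pi>: "\<pi> permutes {1..2*n}"
  shows "off_diag {1..n} (\<lambda>i j. (M i j)\<^sup>2) \<le> 4 * overlap_energy n d X"
proof -
  define G where "G i j = overlap n X d (\<pi> i) (\<pi> j)" for i j
  have M: "M i j = G i j - G i (j + n) - G (i + n) j + G (i + n) (j + n)" for i j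
    unfolding M_def B_def G_def overlap_def
    by (simp add: algebra_simps add_divide_distrib diff_divide_distrib sum.distrib sum_subtractf)
  have sq: "(a - b - c + e)\<^sup>2 \<le> 4 * (a\<^sup>2 + b\<^sup>2 + c\<^sup>2 + e\<^sup>2)" for a b c e :: real
  proof -
    \<comment> \<open>Lagrange's identity: the six squares add up to the difference of the two
      sides.\<close>
    have "0 \<le> (a + b)\<^sup>2 + (a + c)\<^sup>2 + (a - e)\<^sup>2 + (b - c)\<^sup>2 + (b + e)\<^sup>2 + (c + e)\<^sup>2" by simp
    then show ?thesis by (simp add: power2_eq_square algebra_simps)
  qed
  have "off_diag {1..n} (\<lambda>i j. (M i j)\<^sup>2)
    \<le> off_diag {1..n} (\<lambda>i j. 4 * ((G i j)\<^sup>2 + (G i (j + n))\<^sup>2 + (G (i + n) j)\<^sup>2 + (G (i + n) (j + n))\<^sup>2))"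
    unfolding M by (intro off_diag_mono sq)
  also have "\<dots> \<le> 4 * off_diag {1..2*n} (\<lambda>i j. (G i j)\<^sup>2)"
    unfolding off_diag_cmult
    by (intro mult_left_mono off_diag_double_ge[of "\<lambda>i j. (G i j)\<^sup>2"]) auto
  also have "off_diag {1..2*n} (\<lambda>i j. (G i j)\<^sup>2) = overlap_energy n d X"
    unfolding G_def overlap_energy_def
    by (rule off_diag_permute[OF \<pi>, of "\<lambda>i j. (overlap n X d i j)\<^sup>2"]) simp
  finally show ?thesis .
qed

text \<open>
  The uniform permutation is first composed with independent random swaps of \<open>i\<close> and \<open>i + n\<close>;
  conditionally on the permutation, the statistic is then a Rademacher chaos of order two.
\<close>
lemma perm_stat_exp_moment:
  assumes R: "R > 0" and S: "4 * overlap_energy n d X \<le> R\<^sup>2"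
  shows "(\<Sum>\<pi> | \<pi> permutes {1..2*n}. exp ((perm_stat n d X \<pi> - diag_part n d X) / (4 * R)))
    \<le> fact (2*n) * exp (3 / 16)"
proof -
  define P where "P = {\<pi>. \<pi> permutes {1..2*n}}"
  define E where "E \<pi> = exp ((perm_stat n d X \<pi> - diag_part n d X) / (4 * R))" for \<pi>
  have inner: "(\<Sum>I\<in>Pow {1..n}. E (\<pi> \<circ> swap_rows n I)) \<le> 2 ^ n * exp (3 / 16)" if "\<pi> \<in> P" for \<pi>
  proof -
    have \<pi>: "\<pi> permutes {1..2*n}" using that by (simp add: P_def)
    define B where "B i k = real (X (\<pi> i, k)) - real (X (\<pi> (i + n), k))" for i k
    define M where "M i j = (\<Sum>k=1..d. B i k * B j k / col_sum n X k)" for i j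
    \<comment> \<open>Dividing by \<open>4 * R\<close> brings a squared Frobenius norm of at most
      \<open>R^2\<close> down to the threshold 1/16 of the chaos bound; hence the exponent
      3/16.\<close>
    define A where "A i j = M i j / (4 * R)" for i j
    have sym: "A i j = A j i" for i j by (simp add: A_def M_def mult.commute)
    have "off_diag {1..n} (\<lambda>i j. (A i j)\<^sup>2) = 1 / (4 * R)\<^sup>2 * off_diag {1..n} (\<lambda>i j. (M i j)\<^sup>2)"
      unfolding off_diag_cmult[symmetric] A_def by (simp add: power_divide)
    also have "\<dots> \<le> 1 / (4 * R)\<^sup>2 * R\<^sup>2"
      using diff_overlap_energy_le[OF \<pi>, of X d] S unfolding M_def B_def by (intro mult_left_mono) auto
    also have "\<dots> = 1 / 16" using R by (simp add: power_mult_distrib)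
    finally have F: "off_diag {1..n} (\<lambda>i j. (A i j)\<^sup>2) \<le> 1 / 16" .
    have "E (\<pi> \<circ> swap_rows n I) \<le> exp (off_diag {1..n} (\<lambda>i j. A i j * rsign I i * rsign I j))"
      if "I \<in> Pow {1..n}" for I
    proof -
      have "(perm_stat n d X (\<pi> \<circ> swap_rows n I) - diag_part n d X) / (4 * R)
          \<le> 1 / (4 * R) * off_diag {1..n} (\<lambda>i j. M i j * rsign I i * rsign I j)"
        using perm_stat_swap_le[OF \<pi>, of I d X] that R unfolding M_def B_def
        by (simp add: divide_right_mono)
      also have "\<dots> = off_diag {1..n} (\<lambda>i j. A i j * rsign I i * rsign I j)"
        unfolding off_diag_cmult[symmetric] A_def by simp
      finally show ?thesis unfolding E_def by simp
    qed
    then have "(\<Sum>I\<in>Pow {1..n}. E (\<pi> \<circ> swap_rows n I))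
      \<le> (\<Sum>I\<in>Pow {1..n}. exp (off_diag {1..n} (\<lambda>i j. A i j * rsign I i * rsign I j)))"
      by (rule sum_mono)
    also have "\<dots> \<le> 2 ^ card {1..n} * exp (3 * off_diag {1..n} (\<lambda>i j. (A i j)\<^sup>2))"
      by (rule rademacher_chaos_exp[OF _ sym F]) simp
    also have "\<dots> \<le> 2 ^ n * exp (3 / 16)" using F by simp
    finally show ?thesis .
  qed
  have "2 ^ n * sum E P = (\<Sum>I\<in>Pow {1..n}. sum E P)" by (simp add: card_Pow)
  also have "\<dots> = (\<Sum>I\<in>Pow {1..n}. \<Sum>\<pi>\<in>P. E (\<pi> \<circ> swap_rows n I))"
    unfolding P_def by (intro sum.cong refl sum_permutations_compose_right swap_rows_permutes)
  also have "\<dots> = (\<Sum>\<pi>\<in>P. \<Sum>I\<in>Pow {1..n}. E (\<pi> \<circ> swap_rows n I))" by (rule sum.swap)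
  also have "\<dots> \<le> (\<Sum>\<pi>\<in>P. 2 ^ n * exp (3 / 16))" by (intro sum_mono inner)
  also have "\<dots> = 2 ^ n * (fact (2*n) * exp (3 / 16))"
    unfolding P_def by (simp add: card_permutations[OF refl])
  finally show ?thesis unfolding E_def P_def by simp
qed

section \<open>Quantiles of the permutation distribution\<close>

definition crit_value :: "nat \<Rightarrow> nat \<Rightarrow> real \<Rightarrow> sample \<Rightarrow> real" where
  "crit_value n d \<alpha> X =
     Inf {t. 1 / fact (2 * n) * (\<Sum>\<pi> | \<pi> permutes {1..2 * n}. of_bool (perm_stat n d X \<pi> \<le> t)) \<ge> 1 - \<alpha>}"

text \<open>The distribution function is a right-continuous step function that jumps only at values
  \<open>x \<pi>\<close>, so the admissible thresholds form a closed half-line starting at one of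
  them. \<open>0 < q\<close> bounds this set below, \<open>q \<le> c * card P\<close> makes it
  nonempty.\<close>

lemma weighted_quantile_eq_atLeast:
  fixes x :: "'a \<Rightarrow> real" and c :: real
  assumes "finite P" "c > 0" "0 < q" "q \<le> c * card P"
  shows "\<exists>t0. {t. c * (\<Sum>\<pi>\<in>P. of_bool (x \<pi> \<le> t)) \<ge> q} = {t0..}"
proof -
  define F where "F t = c * (\<Sum>\<pi>\<in>P. of_bool (x \<pi> \<le> t))" for t
  define V where "V = {v \<in> x ` P. F v \<ge> q}"
  have mono: "F s \<le> F t" if "s \<le> t" for s t
    unfolding F_def using that assms(2) by (intro mult_left_mono sum_mono) auto
  have P: "P \<noteq> {}" using assms by auto
  have "F (Max (x ` P)) = c * (\<Sum>\<pi>\<in>P. 1)"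
    unfolding F_def using assms(1) by (intro arg_cong2[where f="(*)"] sum.cong) auto
  then have "Max (x ` P) \<in> V" unfolding V_def using assms P by auto
  moreover have finV: "finite V" unfolding V_def using assms(1) by simp
  ultimately have mV: "Min V \<in> V" by (metis Min_in empty_iff)
  have "F t \<ge> q \<longleftrightarrow> Min V \<le> t" for t
  proof
    assume t: "F t \<ge> q"
    \<comment> \<open>\<open>Max W\<close> will be the last value at or before \<open>t\<close>; the
      distribution function agrees at the two points.\<close>
    define W where "W = {v \<in> x ` P. v \<le> t}"
    have "W \<noteq> {}"
    proof
      assume "W = {}"
      then have "F t = 0" unfolding F_def W_def by (auto intro!: sum.neutral)
      then show False using t assms(3) by simp
    qed
    moreover have "finite W" unfolding W_def using assms(1) by simp
    ultimately have m: "Max W \<in> W" "finite W" by simp_all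
    have iff: "x \<pi> \<le> t \<longleftrightarrow> x \<pi> \<le> Max W" if "\<pi> \<in> P" for \<pi>
    proof
      assume "x \<pi> \<le> t"
      then have "x \<pi> \<in> W" using that by (simp add: W_def)
      then show "x \<pi> \<le> Max W" using m(2) by simp
    next
      assume "x \<pi> \<le> Max W"
      moreover have "Max W \<le> t" using m(1) unfolding W_def by blast
      ultimately show "x \<pi> \<le> t" by linarith
    qed
    have "(\<Sum>\<pi>\<in>P. of_bool (x \<pi> \<le> t) :: real) = (\<Sum>\<pi>\<in>P. of_bool (x \<pi> \<le> Max W))"
      by (intro sum.cong refl) (simp only: iff)
    then have "F (Max W) \<ge> q" using t unfolding F_def by simp
    moreover have W: "Max W \<in> x ` P" "Max W \<le> t" using m(1) unfolding W_def by blast+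
    ultimately have "Max W \<in> V" unfolding V_def by simp
    then have "Min V \<le> Max W" using finV by simp
    then show "Min V \<le> t" using W(2) by simp
  next
    assume "Min V \<le> t"
    then show "F t \<ge> q" using mono[of "Min V" t] mV unfolding V_def by auto
  qed
  then show ?thesis unfolding F_def by (intro exI[of _ "Min V"]) auto
qed

text \<open>The infimum is attained, so quantile and distribution function are adjoint. Bounds on
  the critical value thereby reduce to counting permutations.\<close>

lemma crit_value_le_iff:
  assumes "0 \<le> \<alpha>" "\<alpha> < 1"
  shows "crit_value n d \<alpha> X \<le> t \<longleftrightarrow>
     1 / fact (2 * n) * (\<Sum>\<pi> | \<pi> permutes {1..2 * n}. of_bool (perm_stat n d X \<pi> \<le> t)) \<ge> 1 - \<alpha>"
proof -
  have "card {\<pi>. \<pi> permutes {1..2 * n}} = fact (2 * n)" by (simp add: card_permutations[OF refl])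
  then obtain t0 where S: "{t. 1 / fact (2 * n) * (\<Sum>\<pi> | \<pi> permutes {1..2 * n}. of_bool (perm_stat n d X \<pi> \<le> t)) \<ge> 1 - \<alpha>} = {t0..}"
    using weighted_quantile_eq_atLeast[of "{\<pi>. \<pi> permutes {1..2 * n}}" "1 / fact (2*n)" "1 - \<alpha>" "perm_stat n d X"] assms
    by (auto simp: finite_permutations)
  have "Inf {t0..} \<le> t \<longleftrightarrow> t \<in> {t0..}" by simp
  then show ?thesis unfolding crit_value_def S[symmetric] by simp
qed

lemma of_bool_le_eq: "(of_bool (x \<le> t) :: real) = 1 - of_bool (t < x)" for x t :: real
  by auto

lemma sum_of_bool_le:
  "(\<Sum>\<pi> | \<pi> permutes {1..2 * n}. of_bool (f \<pi> \<le> (t::real)) :: real)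
    = fact (2*n) - (\<Sum>\<pi> | \<pi> permutes {1..2 * n}. of_bool (f \<pi> > t))"
  unfolding of_bool_le_eq sum_subtractf by (simp add: card_permutations[OF refl])

lemma crit_value_exceed_le:
  assumes "0 \<le> \<alpha>" "\<alpha> < 1"
  shows "(\<Sum>\<pi> | \<pi> permutes {1..2 * n}. of_bool (perm_stat n d X \<pi> > crit_value n d \<alpha> X)) \<le> \<alpha> * fact (2*n)"
proof -
  have "1 - \<alpha> \<le> 1 / fact (2 * n) * (\<Sum>\<pi> | \<pi> permutes {1..2 * n}. of_bool (perm_stat n d X \<pi> \<le> crit_value n d \<alpha> X))"
    using crit_value_le_iff[OF assms] by blast
  then show ?thesis unfolding sum_of_bool_le by (simp add: field_simps)
qed

text \<open>Exponential Markov inequality at scale \<open>4 * R\<close>: exceeding the threshold by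
  \<open>8 * ln (1 / \<alpha>) * R\<close> means an exponent of
  \<open>2 * ln (1 / \<alpha>)\<close>. One of the two logarithms absorbs
  \<open>exp (3 / 16)\<close>, because \<open>\<alpha> < exp (-1)\<close> makes it larger than 1;
  the other yields the factor \<alpha>.\<close>

lemma crit_value_le:
  assumes "0 < \<alpha>" "\<alpha> < exp (-1)" "R > 0" "4 * overlap_energy n d X \<le> R\<^sup>2"
  shows "crit_value n d \<alpha> X \<le> diag_part n d X + 8 * ln (1 / \<alpha>) * R"
proof -
  define t where "t = diag_part n d X + 8 * ln (1 / \<alpha>) * R"
  define P where "P = {\<pi>. \<pi> permutes {1..2 * n}}"
  have a1: "\<alpha> < 1" using assms(2) by (smt (verit) exp_less_one_iff)
  have L: "ln (1 / \<alpha>) > 1" using assms(1,2) by (simp add: ln_div) (metis exp_less_cancel_iff exp_ln minus_less_iff)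
  have "exp (2 * ln (1 / \<alpha>)) * (\<Sum>\<pi>\<in>P. of_bool (perm_stat n d X \<pi> > t))
     \<le> (\<Sum>\<pi>\<in>P. exp ((perm_stat n d X \<pi> - diag_part n d X) / (4 * R)))"
    unfolding sum_distrib_left
  proof (intro sum_mono)
    fix \<pi>
    have "2 * ln (1 / \<alpha>) \<le> (perm_stat n d X \<pi> - diag_part n d X) / (4 * R)" if "perm_stat n d X \<pi> > t"
      using that assms(3) unfolding t_def by (simp add: field_simps)
    then show "exp (2 * ln (1 / \<alpha>)) * of_bool (perm_stat n d X \<pi> > t) \<le> exp ((perm_stat n d X \<pi> - diag_part n d X) / (4 * R))"
      by auto
  qed
  also have "\<dots> \<le> fact (2*n) * exp (3 / 16)" unfolding P_def by (rule perm_stat_exp_moment[OF assms(3,4)])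
  also have "\<dots> \<le> fact (2*n) * exp (ln (1 / \<alpha>))" using L by (intro mult_left_mono) auto
  finally have "exp (ln (1 / \<alpha>)) * (\<Sum>\<pi>\<in>P. of_bool (perm_stat n d X \<pi> > t)) \<le> fact (2*n)"
    by (simp only: mult_2 exp_add) simp
  then have "(\<Sum>\<pi>\<in>P. of_bool (perm_stat n d X \<pi> > t)) \<le> \<alpha> * fact (2*n)"
    using assms(1) by (simp add: field_simps)
  then show ?thesis
    using crit_value_le_iff[of \<alpha> n d X t] assms(1) a1 unfolding sum_of_bool_le P_def t_def
    by (simp add: field_simps)
qed

section \<open>The Mecke identity and factorial moments\<close>

text \<open>The mass at \<open>y + 1\<close> times \<open>y + 1\<close> is \<open>a\<close> times
  the mass at \<open>y\<close>, followed by an index shift. In \<open>ennreal\<close> no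
  integrability has to be discussed.\<close>

lemma nn_integral_poisson_size_bias:
  assumes "a \<ge> 0"
  shows "(\<integral>\<^sup>+y. of_nat y * f y \<partial>measure_pmf (poisson a)) = ennreal a * (\<integral>\<^sup>+y. f (Suc y) \<partial>measure_pmf (poisson a))"
proof (cases "a > 0")
  case True
  have eq: "ennreal (pmf (poisson_pmf a) (Suc y)) * of_nat (Suc y) = ennreal a * ennreal (pmf (poisson_pmf a) y)" for y
    unfolding ennreal_of_nat_eq_real_of_nat using True
    by (simp add: ennreal_mult[symmetric] field_simps del: of_nat_Suc)
  have "(\<integral>\<^sup>+y. of_nat y * f y \<partial>measure_pmf (poisson_pmf a))
      = (\<Sum>y. ennreal (pmf (poisson_pmf a) y) * (of_nat y * f y))"
    by (simp add: nn_integral_measure_pmf nn_integral_count_space_nat)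
  also have "\<dots> = (\<Sum>y. ennreal (pmf (poisson_pmf a) (Suc y)) * (of_nat (Suc y) * f (Suc y)))"
    using suminf_offset[of "\<lambda>y. ennreal (pmf (poisson_pmf a) y) * (of_nat y * f y)" 1] by simp
  also have "\<dots> = (\<Sum>y. ennreal a * (ennreal (pmf (poisson_pmf a) y) * f (Suc y)))"
    by (simp only: mult.assoc[symmetric] eq)
  also have "\<dots> = ennreal a * (\<Sum>y. ennreal (pmf (poisson_pmf a) y) * f (Suc y))"
    by simp
  also have "\<dots> = ennreal a * (\<integral>\<^sup>+y. f (Suc y) \<partial>measure_pmf (poisson_pmf a))"
    by (simp add: nn_integral_measure_pmf nn_integral_count_space_nat)
  finally show ?thesis using True by (simp add: poisson_def)
next
  \<comment> \<open>At rate 0 the count is almost surely 0, so both sides vanish.\<close>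
  case False
  then show ?thesis using assms by (simp add: poisson_def)
qed

locale poisson_field =
  fixes I :: "'i set" and a :: "'i \<Rightarrow> real"
  assumes fin: "finite I" and a_nonneg: "\<And>x. x \<in> I \<Longrightarrow> 0 \<le> a x"
begin

definition F :: "('i \<Rightarrow> nat) pmf" where
  "F = Pi_pmf I 0 (\<lambda>x. poisson (a x))"

abbreviation bump :: "'i \<Rightarrow> ('i \<Rightarrow> nat) \<Rightarrow> 'i \<Rightarrow> nat" where
  "bump x X \<equiv> X(x := Suc (X x))"

text \<open>By independence the coordinate at \<open>x\<close> splits off, and with the other
  coordinates fixed the one-dimensional identity applies.\<close>

lemma nn_mecke:
  assumes x: "x \<in> I"
  shows "(\<integral>\<^sup>+X. of_nat (X x) * f X \<partial>measure_pmf F) = ennreal (a x) * (\<integral>\<^sup>+X. f (bump x X) \<partial>measure_pmf F)"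
proof -
  define J where "J = I - {x}"
  have J: "I = insert x J" "finite J" "x \<notin> J" using x fin by (auto simp: J_def)
  define G where "G = Pi_pmf J 0 (\<lambda>x. poisson (a x))"
  have F: "measure_pmf F = measure_pmf (map_pmf (\<lambda>(g, y). g(x := y)) (pair_pmf G (poisson (a x))))"
  proof -
    have "Pi_pmf I 0 (\<lambda>x. poisson (a x)) = map_pmf (\<lambda>(y, g). g(x := y)) (pair_pmf (poisson (a x)) G)"
      unfolding G_def by (subst J(1), rule Pi_pmf_insert[OF J(2,3)])
    then show ?thesis
      unfolding F_def by (subst pair_commute_pmf) (simp add: pmf.map_comp o_def case_prod_unfold)
  qed
  show ?thesis
    unfolding F using a_nonneg[OF x]
    by (simp add: nn_integral_pair_pmf' nn_integral_poisson_size_bias nn_integral_cmult)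
qed

text \<open>Integrability is asked of the bumped function, whose denominators are away from 0, and
  passes to the weighted one. Positive and negative parts then give the equation.\<close>

lemma mecke:
  assumes x: "x \<in> I" and int: "integrable (measure_pmf F) (\<lambda>X. f (bump x X) :: real)"
  shows "integrable (measure_pmf F) (\<lambda>X. real (X x) * f X)"
    and "measure_pmf.expectation F (\<lambda>X. real (X x) * f X) = a x * measure_pmf.expectation F (\<lambda>X. f (bump x X))"
proof -
  have nn: "(\<integral>\<^sup>+X. ennreal (real (X x) * g X) \<partial>measure_pmf F) = ennreal (a x) * (\<integral>\<^sup>+X. ennreal (g (bump x X)) \<partial>measure_pmf F)" for g
    using nn_mecke[OF x, of "\<lambda>X. ennreal (g X)"] by (simp add: ennreal_mult'' ennreal_of_nat_eq_real_of_nat ennreal_mult')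
  have "(\<integral>\<^sup>+X. ennreal (norm (real (X x) * f X)) \<partial>measure_pmf F)
     = ennreal (a x) * (\<integral>\<^sup>+X. ennreal (norm (f (bump x X))) \<partial>measure_pmf F)"
    using nn[of "\<lambda>X. norm (f X)"] by (simp add: abs_mult)
  also have "\<dots> < \<infinity>" using int by (simp add: integrable_iff_bounded ennreal_mult_less_top)
  finally show int2: "integrable (measure_pmf F) (\<lambda>X. real (X x) * f X)"
    by (intro integrableI_bounded) auto
  have "(\<integral>\<^sup>+X. ennreal (- (real (X x) * f X)) \<partial>measure_pmf F) = ennreal (a x) * (\<integral>\<^sup>+X. ennreal (- f (bump x X)) \<partial>measure_pmf F)"
    using nn[of "\<lambda>X. - f X"] by simp
  then show "measure_pmf.expectation F (\<lambda>X. real (X x) * f X) = a x * measure_pmf.expectation F (\<lambda>X. f (bump x X))"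
    using a_nonneg[OF x]
    by (simp add: real_lebesgue_integral_def[OF int] real_lebesgue_integral_def[OF int2] nn enn2real_mult right_diff_distrib)
qed

text \<open>If bumping any cell of \<open>A\<close> has the same effect on \<open>f\<close>, the
  single-cell identities add up and only the total rate of \<open>A\<close> survives. Functions of
  totals over \<open>A\<close> behave this way.\<close>

lemma mecke_sum:
  assumes A: "A \<subseteq> I" and f: "\<And>x X. x \<in> A \<Longrightarrow> f (bump x X) = (g X :: real)"
    and int: "integrable (measure_pmf F) g"
  shows "integrable (measure_pmf F) (\<lambda>X. (\<Sum>x\<in>A. real (X x)) * f X)"
    and "measure_pmf.expectation F (\<lambda>X. (\<Sum>x\<in>A. real (X x)) * f X) = sum a A * measure_pmf.expectation F g"
proof -
  have i: "integrable (measure_pmf F) (\<lambda>X. f (bump x X))" if "x \<in> A" for x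
    using int by (simp add: f[OF that])
  have i2: "integrable (measure_pmf F) (\<lambda>X. real (X x) * f X)"
    "measure_pmf.expectation F (\<lambda>X. real (X x) * f X) = a x * measure_pmf.expectation F g" if "x \<in> A" for x
    using mecke[OF subsetD[OF A that] i[OF that]] unfolding f[OF that] by blast+
  show "integrable (measure_pmf F) (\<lambda>X. (\<Sum>x\<in>A. real (X x)) * f X)"
    unfolding sum_distrib_right by (intro Bochner_Integration.integrable_sum i2)
  show "measure_pmf.expectation F (\<lambda>X. (\<Sum>x\<in>A. real (X x)) * f X) = sum a A * measure_pmf.expectation F g"
    unfolding sum_distrib_right
    by (subst Bochner_Integration.integral_sum) (auto intro!: i2 sum.cong)
qed

lemma integrable_bounded: "(\<And>X. \<bar>f X\<bar> \<le> (B::real)) \<Longrightarrow> integrable (measure_pmf F) f"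
  by (intro measure_pmf.integrable_const_bound[where B = B]) auto

end

text \<open>The falling factorial, over the reals so that \<open>x - 1\<close> is not truncated at
  0. Taking off \<open>x\<close> and shifting the rest matches one Mecke step, which raises the
  total by one and undoes the shift.\<close>

primrec falling :: "nat \<Rightarrow> real \<Rightarrow> real" where
  "falling 0 x = 1"
| "falling (Suc j) x = x * falling j (x - 1)"

context poisson_field
begin

lemma sum_bump:
  assumes "finite A"
  shows "(\<Sum>y\<in>A. bump x X y) = (if x \<in> A then Suc (\<Sum>y\<in>A. X y) else (\<Sum>y\<in>A. X y))"
proof (cases "x \<in> A")
  case True
  then show ?thesis using assms by (simp add: sum.remove[of A x])
next
  case False
  then have "(\<Sum>y\<in>A. bump x X y) = (\<Sum>y\<in>A. X y)" by (intro sum.cong) auto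
  then show ?thesis using False by simp
qed

text \<open>Each Mecke step consumes one factor of a falling factorial, produces the total rate of
  its set, and raises the argument of \<open>h\<close> by one. Hence \<open>h\<close> is generalized
  in both inductions; its boundedness is the only source of integrability.\<close>

lemma factorial_moment:
  assumes "A \<subseteq> I" "B \<subseteq> I" "A \<inter> B = {}" and h: "\<And>m. \<bar>h m\<bar> \<le> (K::real)"
  shows "integrable (measure_pmf F) (\<lambda>X. falling j (real (\<Sum>x\<in>A. X x)) * falling l (real (\<Sum>x\<in>B. X x)) * h ((\<Sum>x\<in>A. X x) + (\<Sum>x\<in>B. X x)))" (is ?A)
    and "measure_pmf.expectation F (\<lambda>X. falling j (real (\<Sum>x\<in>A. X x)) * falling l (real (\<Sum>x\<in>B. X x)) * h ((\<Sum>x\<in>A. X x) + (\<Sum>x\<in>B. X x)))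
      = sum a A ^ j * sum a B ^ l * measure_pmf.expectation F (\<lambda>X. h ((\<Sum>x\<in>A. X x) + (\<Sum>x\<in>B. X x) + j + l))" (is ?B)
proof -
  have finAB: "finite A" "finite B" using assms(1,2) fin finite_subset by auto
  have "?A \<and> ?B" using h
  proof (induction j arbitrary: h)
    case 0
    show ?case using 0
    proof (induction l arbitrary: h)
      case 0
      then show ?case by (auto intro: integrable_bounded)
    next
      case (Suc l)
      define f where "f X = falling l (real (\<Sum>x\<in>B. X x) - 1) * h ((\<Sum>x\<in>A. X x) + (\<Sum>x\<in>B. X x))" for X
      define g where "g X = falling l (real (\<Sum>x\<in>B. X x)) * h (Suc ((\<Sum>x\<in>A. X x) + (\<Sum>x\<in>B. X x)))" for X
      have fg: "f (bump x X) = g X" if "x \<in> B" for x X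
        using that assms(3) finAB unfolding f_def g_def by (auto simp: sum_bump simp del: fun_upd_apply)
      have IH: "integrable (measure_pmf F) g"
        "measure_pmf.expectation F g = sum a B ^ l * measure_pmf.expectation F (\<lambda>X. h (Suc ((\<Sum>x\<in>A. X x) + (\<Sum>x\<in>B. X x) + l)))"
        using Suc.IH[of "\<lambda>m. h (Suc m)"] Suc.prems unfolding g_def by auto
      show ?case
        using mecke_sum[OF assms(2) fg IH(1)] IH(2) by (simp add: f_def mult.assoc)
    qed
  next
    case (Suc j)
    define f where "f X = falling j (real (\<Sum>x\<in>A. X x) - 1) * falling l (real (\<Sum>x\<in>B. X x)) * h ((\<Sum>x\<in>A. X x) + (\<Sum>x\<in>B. X x))" for X
    define g where "g X = falling j (real (\<Sum>x\<in>A. X x)) * falling l (real (\<Sum>x\<in>B. X x)) * h (Suc ((\<Sum>x\<in>A. X x) + (\<Sum>x\<in>B. X x)))" for X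
    have fg: "f (bump x X) = g X" if "x \<in> A" for x X
      using that assms(3) finAB unfolding f_def g_def by (auto simp: sum_bump simp del: fun_upd_apply)
    have IH: "integrable (measure_pmf F) g"
      "measure_pmf.expectation F g = sum a A ^ j * sum a B ^ l * measure_pmf.expectation F (\<lambda>X. h (Suc ((\<Sum>x\<in>A. X x) + (\<Sum>x\<in>B. X x) + j + l)))"
      using Suc.IH[of "\<lambda>m. h (Suc m)"] Suc.prems unfolding g_def by auto
    show ?case
      using mecke_sum[OF assms(1) fg IH(1)] IH(2) by (simp add: f_def mult.assoc)
  qed
  then show ?A ?B by auto
qed

end

section \<open>Moments in the two-sample model\<close>

locale two_sample =
  fixes n d :: nat and p q :: "nat \<Rightarrow> real"
  assumes n: "n \<ge> 1" and d: "d \<ge> 1"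
    and p_nonneg: "\<And>k. 0 \<le> p k" and q_nonneg: "\<And>k. 0 \<le> q k"
    and p_sum: "(\<Sum>k=1..d. p k) = 1" and q_sum: "(\<Sum>k=1..d. q k) = 1"
begin

definition cells :: "(nat \<times> nat) set" where "cells = {1..2*n} \<times> {1..d}"

definition rate :: "nat \<times> nat \<Rightarrow> real" where
  "rate = (\<lambda>(i, k). if i \<le> n then p k else q k)"

sublocale poisson_field cells rate
  by unfold_locales (auto simp: cells_def rate_def p_nonneg q_nonneg)

abbreviation E :: "(sample \<Rightarrow> real) \<Rightarrow> real" where
  "E f \<equiv> measure_pmf.expectation F f"

definition col :: "nat \<Rightarrow> (nat \<times> nat) set" where "col k = {1..2*n} \<times> {k}"

definition N :: "sample \<Rightarrow> nat \<Rightarrow> nat" where "N X k = (\<Sum>x\<in>col k. X x)"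

definition g :: "nat \<Rightarrow> real" where "g k = p k + q k"

text \<open>The mean of the column total \<open>N X k\<close>.\<close>

definition lam :: "nat \<Rightarrow> real" where "lam k = real n * g k"

lemma g_nonneg: "0 \<le> g k" and lam_nonneg: "0 \<le> lam k"
  using p_nonneg[of k] q_nonneg[of k] by (auto simp: g_def lam_def)

lemma g_sum: "(\<Sum>k=1..d. g k) = 2"
  unfolding g_def sum.distrib p_sum q_sum by simp

lemma col_subset: "k \<in> {1..d} \<Longrightarrow> col k \<subseteq> cells"
  by (auto simp: col_def cells_def)

lemma finite_col: "finite (col k)" by (simp add: col_def)

lemma N_eq: "N X k = (\<Sum>i=1..2*n. X (i, k))"
proof -
  have "col k = (\<lambda>i. (i, k)) ` {1..2*n}" by (auto simp: col_def)
  then show ?thesis unfolding N_def by (simp add: sum.reindex inj_on_def)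
qed

lemma col_sum_N: "col_sum n X k = real (N X k)"
  by (simp add: col_sum_def N_eq)

lemma sum_rows: "(\<Sum>i=1..2*n. f (rate (i, k))) = real n * f (p k) + real n * f (q k)" for f :: "real \<Rightarrow> real"
proof -
  have "(\<Sum>i=1..2*n. f (rate (i, k))) = (\<Sum>i=1..n. f (p k) + f (q k))"
    unfolding sum_double by (intro sum.cong) (auto simp: rate_def)
  then show ?thesis by (simp add: distrib_left)
qed

lemma rate_row_sum: "(\<Sum>i=1..2*n. rate (i, k)) = lam k"
  using sum_rows[of "\<lambda>x. x" k] by (simp add: lam_def g_def distrib_left)

lemma rate_sum_col: "sum rate (col k) = lam k"
proof -
  have "col k = (\<lambda>i. (i, k)) ` {1..2*n}" by (auto simp: col_def)
  then show ?thesis using rate_row_sum[of k] by (simp add: sum.reindex inj_on_def)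
qed

lemma rate_le_g: "rate (i, k) \<le> g k" and rate_nonneg: "0 \<le> rate x"
  using p_nonneg q_nonneg by (auto simp: rate_def g_def split: prod.splits)

lemma N_bump: "N (bump x X) k = (if x \<in> col k then Suc (N X k) else N X k)"
  unfolding N_def by (rule sum_bump[OF finite_col])

lemma le_N: "x \<in> col k \<Longrightarrow> X x \<le> N X k"
  unfolding N_def by (intro member_le_sum finite_col) auto

lemma moment_N:
  assumes "k \<in> {1..d}" "\<And>m. \<bar>h m\<bar> \<le> (K::real)"
  shows "integrable (measure_pmf F) (\<lambda>X. falling j (real (N X k)) * h (N X k))"
    and "E (\<lambda>X. falling j (real (N X k)) * h (N X k)) = lam k ^ j * E (\<lambda>X. h (N X k + j))"
  using factorial_moment[OF col_subset[OF assms(1)] empty_subsetI Int_empty_right assms(2), of j 0]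
  by (simp_all add: rate_sum_col N_def)

lemma integrable_N: "(\<And>m. \<bar>h m\<bar> \<le> (K::real)) \<Longrightarrow> integrable (measure_pmf F) (\<lambda>X. h (N X k))"
  by (rule integrable_bounded) blast

lemma expectation_le_const:
  assumes "integrable (measure_pmf F) f" "\<And>X. f X \<le> c"
  shows "E f \<le> c"
  using measure_pmf.integral_le_const[of F f c] assms by simp

text \<open>Two Mecke steps turn \<open>1 / N\<close> into \<open>1 / (N + 2)\<close>. The
  quantities \<open>e2\<close>, \<open>e11\<close> and \<open>e4\<close> below arise likewise: two
  steps on \<open>1 / N^2\<close>, two steps in each of two columns, and four steps on
  \<open>1 / N^2\<close>.\<close>

definition e1 :: "nat \<Rightarrow> real" where "e1 k = E (\<lambda>X. 1 / (real (N X k) + 2))"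

lemma e1_nonneg: "0 \<le> e1 k"
  unfolding e1_def by (intro integral_nonneg_AE) auto

text \<open>The bounded functions to which the factorial moment formula is applied. Where the
  denominator can vanish, the bound rests on \<open>1 / 0 = 0\<close>.\<close>

lemma inv_bounds: "\<bar>1 / (real m + 1)\<bar> \<le> 1" "\<bar>1 / (real m + 2)\<bar> \<le> 1"
  "\<bar>1 / (real m)\<^sup>2\<bar> \<le> 1" "\<bar>1 / (real m + 2)\<^sup>2\<bar> \<le> 1 / 4"
  "\<bar>1 / real m\<bar> \<le> 1"
proof -
  have "2\<^sup>2 \<le> (real m + 2)\<^sup>2" by (intro power_mono) auto
  then show "\<bar>1 / (real m + 2)\<^sup>2\<bar> \<le> 1 / 4" by (simp add: field_simps)
  show "\<bar>1 / (real m)\<^sup>2\<bar> \<le> 1" by (cases "m = 0") (auto simp: field_simps)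
  show "\<bar>1 / real m\<bar> \<le> 1" by (cases m) auto
qed (auto simp: field_simps)

text \<open>The Mecke identity read backwards: the left side is the mean of
  \<open>N / (N + 1)\<close>.\<close>

lemma lam_e1_le: assumes "k \<in> {1..d}" shows "lam k * e1 k \<le> 1"
proof -
  have "lam k * e1 k = E (\<lambda>X. falling 1 (real (N X k)) * (1 / (real (N X k) + 1)))"
    using moment_N(2)[OF assms, of "\<lambda>m. 1 / (real m + 1)" 1 1, OF inv_bounds(1)] by (simp add: e1_def add.commute add.left_commute)
  also have "\<dots> \<le> 1"
    using moment_N(1)[OF assms, of "\<lambda>m. 1 / (real m + 1)" 1 1, OF inv_bounds(1)] by (intro expectation_le_const) auto
  finally show ?thesis .
qed

text \<open>Jensen's inequality for \<open>1 / y\<close>, by way of the tangent at \<open>c\<close>,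
  the mean of \<open>N + 2\<close>; the linear term has mean zero.\<close>

lemma e1_ge: assumes "k \<in> {1..d}" shows "1 / (lam k + 2) \<le> e1 k"
proof -
  define c where "c = lam k + 2"
  have c: "c > 0" using lam_nonneg[of k] by (simp add: c_def)
  have iN: "integrable (measure_pmf F) (\<lambda>X. real (N X k))" "E (\<lambda>X. real (N X k)) = lam k"
    using moment_N[OF assms, of "\<lambda>_. 1" 1 1] by simp_all
  have pt: "1 / c - (real (N X k) - lam k) / c\<^sup>2 \<le> 1 / (real (N X k) + 2)" for X
  proof -
    define y where "y = real (N X k) + 2"
    have y: "y > 0" by (simp add: y_def)
    have "0 \<le> (y - c)\<^sup>2" by simp
    then have "(2 * c - y) * y \<le> c\<^sup>2" by (simp add: power2_eq_square algebra_simps)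
    then have "(2 * c - y) / c\<^sup>2 \<le> 1 / y" using y c by (simp add: field_simps)
    moreover have "(2 * c - y) / c\<^sup>2 = 1 / c - (real (N X k) - lam k) / c\<^sup>2"
    proof -
      have "2 * c - y = c - (real (N X k) - lam k)" by (simp add: y_def c_def)
      then have "(2 * c - y) / c\<^sup>2 = c / c\<^sup>2 - (real (N X k) - lam k) / c\<^sup>2"
        by (simp only: diff_divide_distrib)
      then show ?thesis using c by (simp add: power2_eq_square)
    qed
    ultimately show ?thesis by (simp add: y_def)
  qed
  have "1 / c = E (\<lambda>X. 1 / c - (real (N X k) - lam k) / c\<^sup>2)" using iN by simp
  also have "\<dots> \<le> e1 k" unfolding e1_def
    using iN(1) by (intro integral_mono pt integrable_N[of "\<lambda>m. 1 / (real m + 2)", OF inv_bounds(2)]) auto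
  finally show ?thesis by (simp add: c_def)
qed

definition e2 :: "nat \<Rightarrow> real" where "e2 k = E (\<lambda>X. 1 / (real (N X k) + 2)\<^sup>2)"

text \<open>Two Mecke steps backwards give the mean of \<open>N * (N - 1) / N^2\<close>, which is at
  most 1. For small \<open>lam k\<close> the crude bound \<open>e2 k \<le> 1 / 4\<close> is better
  and makes sparse categories cheap.\<close>

lemma lam_e2_le: assumes "k \<in> {1..d}" shows "(lam k)\<^sup>2 * e2 k \<le> min 1 (lam k)"
proof -
  have "(lam k)\<^sup>2 * e2 k = E (\<lambda>X. falling 2 (real (N X k)) * (1 / (real (N X k))\<^sup>2))"
    using moment_N(2) [OF assms, of "\<lambda>m. 1 / (real m)\<^sup>2" 1 2, OF inv_bounds(3)] by (simp add: e2_def add.commute)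
  also have "\<dots> \<le> 1"
  proof (intro expectation_le_const)
    show "integrable (measure_pmf F) (\<lambda>X. falling 2 (real (N X k)) * (1 / (real (N X k))\<^sup>2))"
      by (rule moment_N(1)[OF assms, of "\<lambda>m. 1 / (real m)\<^sup>2", OF inv_bounds(3)])
    show "falling 2 (real (N X k)) * (1 / (real (N X k))\<^sup>2) \<le> 1" for X
      by (cases "N X k = 0") (auto simp: numeral_2_eq_2 field_simps)
  qed
  finally have 1: "(lam k)\<^sup>2 * e2 k \<le> 1" .
  have "e2 k \<le> 1 / 4" unfolding e2_def
    using inv_bounds(4) by (intro expectation_le_const integrable_N[of "\<lambda>m. 1 / (real m + 2)\<^sup>2", OF inv_bounds(4)]) (smt (verit, best))
  then have "(lam k)\<^sup>2 * e2 k \<le> (lam k)\<^sup>2 * (1 / 4)" by (intro mult_left_mono) auto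
  also have "\<dots> \<le> lam k" if "lam k \<le> 1"
    using mult_mono[OF that that] that lam_nonneg[of k] mult_right_mono[OF that, of "lam k"]
    by (simp add: power2_eq_square)
  finally show ?thesis using 1 by (cases "lam k \<le> 1") auto
qed

text \<open>Bounding each minimum by 1 gives \<open>d\<close>, bounding it by \<open>lam k\<close>
  gives \<open>2 * n\<close>. This is where \<open>min d n\<close> originates.\<close>

lemma sum_min_lam: "(\<Sum>k=1..d. min 1 (lam k)) \<le> 2 * real (min d n)"
proof -
  have "(\<Sum>k=1..d. min 1 (lam k)) \<le> (\<Sum>k=1..d. 1)" by (intro sum_mono) auto
  moreover have "(\<Sum>k=1..d. min 1 (lam k)) \<le> (\<Sum>k=1..d. lam k)" by (intro sum_mono) auto
  moreover have "(\<Sum>k=1..d. lam k) = 2 * real n"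
    unfolding lam_def sum_distrib_left[symmetric] g_sum by simp
  ultimately show ?thesis by (auto simp: min_def)
qed

section \<open>Mean of the diagonal part\<close>

lemma diag_part_nonneg: "0 \<le> diag_part n d X"
  unfolding diag_part_def
proof (intro sum_nonneg divide_nonneg_nonneg col_sum_nonneg)
  show "0 \<le> real (X (i, k)) * (real (X (i, k)) - 1)" for i k by (cases "X (i, k)") auto
qed

lemma diag_term:
  assumes "k \<in> {1..d}" "i \<in> {1..2*n}"
  shows "integrable (measure_pmf F) (\<lambda>X. real (X (i, k)) * (real (X (i, k)) - 1) / real (N X k))"
    and "E (\<lambda>X. real (X (i, k)) * (real (X (i, k)) - 1) / real (N X k)) = (rate (i, k))\<^sup>2 * e1 k"
proof -
  have x: "(i, k) \<in> col k" using assms(2) by (auto simp: col_def)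
  have A: "{(i, k)} \<subseteq> cells" "col k - {(i, k)} \<subseteq> cells" "{(i, k)} \<inter> (col k - {(i, k)}) = {}"
    using col_subset[OF assms(1)] x by auto
  have Neq: "N X k = (\<Sum>x\<in>{(i, k)}. X x) + (\<Sum>x\<in>col k - {(i, k)}. X x)" for X
    unfolding N_def using x by (simp add: sum.remove[OF finite_col])
  note m = factorial_moment[OF A, of "\<lambda>m. 1 / real m" 1 2 0, OF inv_bounds(5), folded Neq]
  show "integrable (measure_pmf F) (\<lambda>X. real (X (i, k)) * (real (X (i, k)) - 1) / real (N X k))"
    using m(1) by (simp add: numeral_2_eq_2)
  show "E (\<lambda>X. real (X (i, k)) * (real (X (i, k)) - 1) / real (N X k)) = (rate (i, k))\<^sup>2 * e1 k"
    using m(2) by (simp add: numeral_2_eq_2 e1_def add.commute)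
qed

text \<open>Bounding one of the two rates by \<open>g k\<close> and summing the other to
  \<open>lam k\<close> leaves \<open>g k * (lam k * e1 k)\<close>, at most \<open>g k\<close>. The
  masses \<open>g k\<close> sum to 2 for all \<open>n\<close> and \<open>d\<close>.\<close>

lemma diag_part_expectation:
  shows "integrable (measure_pmf F) (diag_part n d)" and "E (diag_part n d) \<le> 2"
proof -
  have eq: "diag_part n d = (\<lambda>X. \<Sum>k=1..d. \<Sum>i=1..2*n. real (X (i, k)) * (real (X (i, k)) - 1) / real (N X k))"
    by (rule ext) (simp add: diag_part_def col_sum_N sum_divide_distrib)
  show int: "integrable (measure_pmf F) (diag_part n d)"
    unfolding eq by (intro Bochner_Integration.integrable_sum diag_term)
  have "E (diag_part n d) = (\<Sum>k=1..d. \<Sum>i=1..2*n. (rate (i, k))\<^sup>2 * e1 k)"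
    unfolding eq
    by (subst Bochner_Integration.integral_sum, intro Bochner_Integration.integrable_sum diag_term, assumption+)
       (intro sum.cong refl trans[OF Bochner_Integration.integral_sum], simp_all only: diag_term)
  also have "\<dots> \<le> (\<Sum>k=1..d. g k)"
  proof (intro sum_mono)
    fix k assume k: "k \<in> {1..d}"
    have "(\<Sum>i=1..2*n. (rate (i, k))\<^sup>2 * e1 k) \<le> (\<Sum>i=1..2*n. (g k * rate (i, k)) * e1 k)"
      unfolding power2_eq_square
      by (intro sum_mono mult_right_mono rate_le_g rate_nonneg e1_nonneg)
    also have "\<dots> = g k * (lam k * e1 k)"
      by (simp only: sum_distrib_right[symmetric] sum_distrib_left[symmetric] rate_row_sum mult.assoc)
    also have "\<dots> \<le> g k * 1" by (intro mult_left_mono lam_e1_le k g_nonneg)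
    finally show "(\<Sum>i=1..2*n. (rate (i, k))\<^sup>2 * e1 k) \<le> g k" by simp
  qed
  finally show "E (diag_part n d) \<le> 2" by (simp only: g_sum)
qed

section \<open>Mean of the overlap energy\<close>

definition Z :: "nat \<Rightarrow> nat \<Rightarrow> nat \<Rightarrow> sample \<Rightarrow> real" where
  "Z i j k X = real (X (i, k)) * real (X (j, k)) / real (N X k)"

lemma overlap_eq: "overlap n X d i j = (\<Sum>k=1..d. Z i j k X)"
  by (simp add: overlap_def Z_def col_sum_N)

text \<open>Since the cells differ, bumping \<open>x\<close> leaves the weight at \<open>y\<close>
  alone, and two single steps can be nested.\<close>

lemma mecke2:
  assumes xy: "x \<in> cells" "y \<in> cells" "x \<noteq> y"
    and f: "\<And>X. f (bump y (bump x X)) = (h X :: real)" and int: "integrable (measure_pmf F) h"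
  shows "integrable (measure_pmf F) (\<lambda>X. real (X x) * (real (X y) * f X))"
    and "E (\<lambda>X. real (X x) * (real (X y) * f X)) = rate x * rate y * E h"
proof -
  have comm: "bump x (bump y X) = bump y (bump x X)" for X
    using xy(3) by (auto simp: fun_upd_twist)
  have yx: "bump x X y = X y" for X using xy(3) by simp
  have i1: "integrable (measure_pmf F) (\<lambda>X. f (bump x (bump y X)))"
    unfolding comm f by (rule int)
  note m1 = mecke[OF xy(2), of "\<lambda>X. f (bump x X)", OF i1]
  have i2: "integrable (measure_pmf F) (\<lambda>X. real (bump x X y) * f (bump x X))"
    unfolding yx by (rule m1(1))
  note m2 = mecke[OF xy(1), of "\<lambda>X. real (X y) * f X", OF i2]
  show "integrable (measure_pmf F) (\<lambda>X. real (X x) * (real (X y) * f X))" by (rule m2(1))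
  have "E (\<lambda>X. real (X x) * (real (X y) * f X)) = rate x * E (\<lambda>X. real (X y) * f (bump x X))"
    using m2(2) unfolding yx .
  also have "E (\<lambda>X. real (X y) * f (bump x X)) = rate y * E h"
    using m1(2) unfolding comm f .
  finally show "E (\<lambda>X. real (X x) * (real (X y) * f X)) = rate x * rate y * E h" by simp
qed

lemma cell_mem:
  assumes "k \<in> {1..d}" "i \<in> {1..2*n}"
  shows "(i, k) \<in> cells" "(i, k) \<in> col k"
  using assms by (auto simp: cells_def col_def)

definition e11 :: "nat \<Rightarrow> nat \<Rightarrow> real" where
  "e11 k l = E (\<lambda>X. 1 / (real (N X k) + 2) * (1 / (real (N X l) + 2)))"

lemma Z_bump_other:
  assumes "k \<noteq> l"
  shows "Z i j l (bump (i', k) X) = Z i j l X"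
proof -
  have "N (bump (i', k) X) l = N X l"
    using assms by (simp add: N_bump col_def del: fun_upd_apply)
  then show ?thesis using assms by (simp add: Z_def)
qed

text \<open>Four Mecke steps, two in each column; bumps in one column do not affect the total of the
  other.\<close>

lemma Z_product_expectation:
  assumes k: "k \<in> {1..d}" and l: "l \<in> {1..d}" and kl: "k \<noteq> l"
    and i: "i \<in> {1..2*n}" and j: "j \<in> {1..2*n}" and ij: "i \<noteq> j"
  shows "integrable (measure_pmf F) (\<lambda>X. Z i j k X * Z i j l X)"
    and "E (\<lambda>X. Z i j k X * Z i j l X) = rate (i, k) * rate (j, k) * (rate (i, l) * rate (j, l)) * e11 k l"
proof -
  note mk = cell_mem[OF k i] cell_mem[OF k j] and ml = cell_mem[OF l i] cell_mem[OF l j]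
  have nk: "(i, k) \<notin> col l" "(j, k) \<notin> col l" "(i, l) \<notin> col k" "(j, l) \<notin> col k"
    using kl by (auto simp: col_def)
  define h2 where "h2 X = 1 / (real (N X k) + 2) * (1 / (real (N X l) + 2))" for X
  \<comment> \<open>Category \<open>k\<close> already has its total raised by 2 here:
    \<open>f2\<close> belongs to the stage after the two steps in column \<open>k\<close>.\<close>
  define f2 where "f2 X = 1 / (real (N X k) + 2) * (1 / real (N X l))" for X
  define f1 where "f1 X = 1 / real (N X k) * Z i j l X" for X
  have h2b: "\<bar>h2 X\<bar> \<le> 1" for X
    unfolding h2_def abs_mult using inv_bounds(2)[of "N X k"] inv_bounds(2)[of "N X l"]
    by (intro mult_le_one) auto
  have s2: "f2 (bump (j, l) (bump (i, l) X)) = h2 X" for X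
    using nk ml by (simp add: f2_def h2_def N_bump add.commute del: fun_upd_apply)
  note m2 = mecke2[OF ml(1,3) _ s2 integrable_bounded[of h2 1, OF h2b]]
  have ne: "(i, l) \<noteq> (j, l)" "(i, k) \<noteq> (j, k)" using ij by auto
  have eq2: "real (X (i, l)) * (real (X (j, l)) * f2 X) = 1 / (real (N X k) + 2) * Z i j l X" for X
    by (simp add: f2_def Z_def)
  have s1: "f1 (bump (j, k) (bump (i, k) X)) = real (X (i, l)) * (real (X (j, l)) * f2 X)" for X
    unfolding eq2 f1_def Z_bump_other[OF kl] using mk by (simp add: N_bump add.commute del: fun_upd_apply)
  note m1 = mecke2[OF mk(1,3) ne(2) s1 m2(1)[OF ne(1)]]
  have eq1: "real (X (i, k)) * (real (X (j, k)) * f1 X) = Z i j k X * Z i j l X" for X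
    by (simp add: f1_def Z_def)
  show "integrable (measure_pmf F) (\<lambda>X. Z i j k X * Z i j l X)"
    using m1(1) unfolding eq1 .
  have "E (\<lambda>X. Z i j k X * Z i j l X) = rate (i, k) * rate (j, k) * (rate (i, l) * rate (j, l) * E h2)"
    using m1(2) unfolding eq1 m2(2)[OF ne(1)] .
  then show "E (\<lambda>X. Z i j k X * Z i j l X) = rate (i, k) * rate (j, k) * (rate (i, l) * rate (j, l)) * e11 k l"
    unfolding e11_def h2_def by (simp only: mult.assoc)
qed

text \<open>One Mecke step backwards in each column: the left side is the mean of a product of two
  ratios \<open>N / (N + 1)\<close>.\<close>

lemma lam_e11_le:
  assumes k: "k \<in> {1..d}" and l: "l \<in> {1..d}" and kl: "k \<noteq> l"
  shows "lam k * lam l * e11 k l \<le> 1"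
proof -
  have nk: "x \<in> col k \<Longrightarrow> x \<notin> col l" "x \<in> col l \<Longrightarrow> x \<notin> col k" for x
    using kl by (auto simp: col_def)
  define f1 where "f1 X = 1 / (real (N X k) + 1) * (1 / (real (N X l) + 2))" for X
  define g1 where "g1 X = 1 / (real (N X k) + 2) * (1 / (real (N X l) + 2))" for X
  define f2 where "f2 X = real (N X k) / (real (N X k) + 1) * (1 / (real (N X l) + 1))" for X
  define g2 where "g2 X = (\<Sum>x\<in>col k. real (X x)) * f1 X" for X
  have NS: "(\<Sum>x\<in>col k. real (X x)) = real (N X k)" for X k by (simp add: N_def)
  have g1b: "\<bar>g1 X\<bar> \<le> 1" for X
    unfolding g1_def abs_mult using inv_bounds(2)[of "N X k"] inv_bounds(2)[of "N X l"]
    by (intro mult_le_one) auto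
  have s1: "f1 (bump x X) = g1 X" if "x \<in> col k" for x X
    using that nk by (simp add: f1_def g1_def N_bump add.commute del: fun_upd_apply)
  note m1 = mecke_sum[OF col_subset[OF k] s1 integrable_bounded[of g1 1, OF g1b]]
  have s2: "f2 (bump x X) = g2 X" if "x \<in> col l" for x X
    unfolding g2_def NS using that nk
    by (simp add: f1_def f2_def N_bump add.commute del: fun_upd_apply)
  have ig2: "integrable (measure_pmf F) g2" using m1(1) unfolding g2_def .
  note m2 = mecke_sum[OF col_subset[OF l] s2 ig2]
  have "E (\<lambda>X. real (N X l) * f2 X) = lam l * (lam k * e11 k l)"
  proof -
    have "E g2 = lam k * e11 k l"
      using m1(2) unfolding g2_def[abs_def] rate_sum_col e11_def g1_def[abs_def] .
    then show ?thesis using m2(2) unfolding rate_sum_col NS by simp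
  qed
  moreover have "E (\<lambda>X. real (N X l) * f2 X) \<le> 1"
  proof (rule expectation_le_const)
    show "integrable (measure_pmf F) (\<lambda>X. real (N X l) * f2 X)" using m2(1) unfolding NS .
    fix X
    have "real (N X l) * f2 X = (real (N X k) / (real (N X k) + 1)) * (real (N X l) / (real (N X l) + 1))"
      by (simp add: f2_def)
    also have "\<dots> \<le> 1" by (intro mult_le_one) auto
    finally show "real (N X l) * f2 X \<le> 1" .
  qed
  ultimately show ?thesis by (simp add: mult_ac)
qed

lemma e11_nonneg: "0 \<le> e11 k l"
  unfolding e11_def by (intro integral_nonneg_AE) auto

text \<open>With every rate replaced by \<open>g\<close>, two of the four factors combine with
  \<open>e11\<close> into a bounded quantity. The remaining \<open>1 / n^2\<close> compensates the
  number of pairs of rows.\<close>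

lemma Z_product_le:
  assumes k: "k \<in> {1..d}" and l: "l \<in> {1..d}" and kl: "k \<noteq> l"
    and i: "i \<in> {1..2*n}" and j: "j \<in> {1..2*n}" and ij: "i \<noteq> j"
  shows "E (\<lambda>X. Z i j k X * Z i j l X) \<le> g k * g l / (real n)\<^sup>2"
proof -
  have "E (\<lambda>X. Z i j k X * Z i j l X) = rate (i, k) * rate (j, k) * (rate (i, l) * rate (j, l)) * e11 k l"
    by (rule Z_product_expectation[OF assms])
  also have "\<dots> \<le> g k * g k * (g l * g l) * e11 k l"
    by (intro mult_right_mono mult_mono rate_le_g rate_nonneg g_nonneg e11_nonneg mult_nonneg_nonneg)
  also have "\<dots> = g k * g l / (real n)\<^sup>2 * (lam k * lam l * e11 k l)"
    using n by (simp add: lam_def power2_eq_square)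
  also have "\<dots> \<le> g k * g l / (real n)\<^sup>2 * 1"
    by (intro mult_left_mono lam_e11_le k l kl divide_nonneg_nonneg mult_nonneg_nonneg g_nonneg) auto
  finally show ?thesis by simp
qed

text \<open>Within one category the squared counts survive two Mecke steps as factors
  \<open>X + 1\<close>. The quotient \<open>h\<close> is still at most 1, as a cell never exceeds
  its column total.\<close>

lemma Z_square_expectation:
  fixes i j k
  defines "h \<equiv> \<lambda>X. (real (X (i, k)) + 1) * (real (X (j, k)) + 1) / (real (N X k) + 2)\<^sup>2"
  assumes k: "k \<in> {1..d}" and i: "i \<in> {1..2*n}" and j: "j \<in> {1..2*n}"
  shows "integrable (measure_pmf F) h"
    and "i \<noteq> j \<Longrightarrow> integrable (measure_pmf F) (\<lambda>X. Z i j k X * Z i j k X)"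
    and "i \<noteq> j \<Longrightarrow> E (\<lambda>X. Z i j k X * Z i j k X) = rate (i, k) * rate (j, k) * E h"
proof -
  note mk = cell_mem[OF k i] cell_mem[OF k j]
  show ih: "integrable (measure_pmf F) h"
  proof (rule integrable_bounded)
    fix X
    have b: "real (X (i, k)) + 1 \<le> real (N X k) + 2" "real (X (j, k)) + 1 \<le> real (N X k) + 2"
      using le_N[OF mk(2), of X] le_N[OF mk(4), of X] by auto
    have "(real (X (i, k)) + 1) * (real (X (j, k)) + 1) \<le> (real (N X k) + 2) * (real (N X k) + 2)"
      by (intro mult_mono b) auto
    then have "h X \<le> 1" unfolding h_def power2_eq_square by (subst divide_le_eq_1_pos) auto
    moreover have "0 \<le> h X" unfolding h_def by simp
    ultimately show "\<bar>h X\<bar> \<le> 1" by simp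
  qed
  define f where "f X = real (X (i, k)) * real (X (j, k)) / (real (N X k))\<^sup>2" for X
  have s: "f (bump (j, k) (bump (i, k) X)) = h X" if "i \<noteq> j" for X
  proof -
    have "N (bump (j, k) (bump (i, k) X)) k = N X k + 2" using mk by (simp add: N_bump del: fun_upd_apply)
    then show ?thesis using that unfolding f_def h_def by (simp add: add.commute)
  qed
  have eq: "real (X (i, k)) * (real (X (j, k)) * f X) = Z i j k X * Z i j k X" for X
    by (simp add: f_def Z_def power2_eq_square)
  show "integrable (measure_pmf F) (\<lambda>X. Z i j k X * Z i j k X)" if "i \<noteq> j"
    using mecke2(1)[OF mk(1,3) _ s[OF that] ih] that unfolding eq by blast
  show "E (\<lambda>X. Z i j k X * Z i j k X) = rate (i, k) * rate (j, k) * E h" if "i \<noteq> j"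
    using mecke2(2)[OF mk(1,3) _ s[OF that] ih] that unfolding eq by blast
qed

text \<open>Under the expectation the double sum over rows is a perfect square: with
  \<open>s\<close> the sum of \<open>rate * (X + 1)\<close> and \<open>y = N + 2\<close> it is
  \<open>(s / y)^2\<close>. The pointwise bound \<open>s \<le> g k * y + lam k\<close> then
  suffices.\<close>

lemma Z_square_sum_le:
  assumes k: "k \<in> {1..d}"
  shows "off_diag {1..2*n} (\<lambda>i j. E (\<lambda>X. Z i j k X * Z i j k X)) \<le> 2 * (g k)\<^sup>2 + 2 * min 1 (lam k)"
proof -
  define h where "h i j X = (real (X (i, k)) + 1) * (real (X (j, k)) + 1) / (real (N X k) + 2)\<^sup>2" for i j and X :: sample
  have ih: "integrable (measure_pmf F) (h i j)" if "i \<in> {1..2*n}" "j \<in> {1..2*n}" for i j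
    using Z_square_expectation(1)[OF k that] unfolding h_def .
  have hnn: "0 \<le> E (h i j)" for i j unfolding h_def by (intro integral_nonneg_AE) auto
  have "off_diag {1..2*n} (\<lambda>i j. E (\<lambda>X. Z i j k X * Z i j k X)) = off_diag {1..2*n} (\<lambda>i j. rate (i, k) * rate (j, k) * E (h i j))"
    unfolding off_diag_def h_def by (intro sum.cong refl Z_square_expectation(3)[OF k]) auto
  \<comment> \<open>Adding the nonnegative terms with \<open>i = j\<close> completes the
    square.\<close>
  also have "\<dots> \<le> (\<Sum>i=1..2*n. \<Sum>j=1..2*n. rate (i, k) * rate (j, k) * E (h i j))"
    unfolding off_diag_def by (intro sum_mono sum_mono2) (auto intro!: mult_nonneg_nonneg hnn rate_nonneg)
  also have "\<dots> = E (\<lambda>X. \<Sum>i=1..2*n. \<Sum>j=1..2*n. rate (i, k) * rate (j, k) * h i j X)"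
    by (subst Bochner_Integration.integral_sum, intro Bochner_Integration.integrable_sum integrable_mult_right ih, assumption+)
       (intro sum.cong refl, subst Bochner_Integration.integral_sum,
        intro integrable_mult_right ih, assumption+, intro sum.cong refl, simp)
  also have "\<dots> \<le> E (\<lambda>X. 2 * (g k)\<^sup>2 + 2 * (lam k)\<^sup>2 * (1 / (real (N X k) + 2)\<^sup>2))"
  proof (rule integral_mono)
    show "integrable (measure_pmf F) (\<lambda>X. \<Sum>i=1..2*n. \<Sum>j=1..2*n. rate (i, k) * rate (j, k) * h i j X)"
      by (intro Bochner_Integration.integrable_sum integrable_mult_right ih)
    show "integrable (measure_pmf F) (\<lambda>X. 2 * (g k)\<^sup>2 + 2 * (lam k)\<^sup>2 * (1 / (real (N X k) + 2)\<^sup>2))"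
      using integrable_N[of "\<lambda>m. 1 / (real m + 2)\<^sup>2" _ k, OF inv_bounds(4)] by (intro Bochner_Integration.integrable_add integrable_mult_right) auto
    fix X :: sample
    define y where "y = real (N X k) + 2"
    have y: "y > 0" by (simp add: y_def)
    define s where "s = (\<Sum>i=1..2*n. rate (i, k) * (real (X (i, k)) + 1))"
    have s0: "0 \<le> s" unfolding s_def by (intro sum_nonneg mult_nonneg_nonneg rate_nonneg) auto
    have "s = (\<Sum>i=1..2*n. rate (i, k) * real (X (i, k))) + lam k"
      unfolding s_def by (simp only: distrib_left sum.distrib mult_1_right rate_row_sum)
    also have "(\<Sum>i=1..2*n. rate (i, k) * real (X (i, k))) \<le> (\<Sum>i=1..2*n. g k * real (X (i, k)))"
      by (intro sum_mono mult_right_mono rate_le_g) auto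
    also have "\<dots> = g k * real (N X k)" by (simp add: N_eq sum_distrib_left)
    also have "\<dots> \<le> g k * y" unfolding y_def by (intro mult_left_mono g_nonneg) auto
    finally have "s \<le> g k * y + lam k" by simp
    then have "s\<^sup>2 \<le> (g k * y + lam k)\<^sup>2" using s0 by (intro power_mono)
    also have "\<dots> \<le> 2 * (g k * y)\<^sup>2 + 2 * (lam k)\<^sup>2"
      using sum_squares_bound[of "g k * y" "lam k"] by (simp add: power2_sum)
    finally have "s\<^sup>2 / y\<^sup>2 \<le> (2 * (g k * y)\<^sup>2 + 2 * (lam k)\<^sup>2) / y\<^sup>2" by (intro divide_right_mono) auto
    also have "\<dots> = 2 * (g k)\<^sup>2 + 2 * (lam k)\<^sup>2 * (1 / y\<^sup>2)"
      using y by (simp add: field_simps power_mult_distrib)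
    also have "s\<^sup>2 / y\<^sup>2 = (\<Sum>i=1..2*n. \<Sum>j=1..2*n. rate (i, k) * rate (j, k) * h i j X)"
      unfolding s_def power2_eq_square[of "sum _ _"] sum_product sum_divide_distrib h_def y_def
      by (intro sum.cong refl) simp
    finally show "(\<Sum>i=1..2*n. \<Sum>j=1..2*n. rate (i, k) * rate (j, k) * h i j X)
       \<le> 2 * (g k)\<^sup>2 + 2 * (lam k)\<^sup>2 * (1 / (real (N X k) + 2)\<^sup>2)" unfolding y_def .
  qed
  also have "\<dots> = 2 * (g k)\<^sup>2 + 2 * ((lam k)\<^sup>2 * e2 k)"
  proof -
    have aff: "E (\<lambda>X. c + b * f X) = c + b * E f" if "integrable (measure_pmf F) f" for c b f
      using that by simp
    show ?thesis unfolding e2_def mult.assoc[symmetric]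
      by (rule aff[OF integrable_N[of "\<lambda>m. 1 / (real m + 2)\<^sup>2" _ k, OF inv_bounds(4)]])
  qed
  also have "\<dots> \<le> 2 * (g k)\<^sup>2 + 2 * min 1 (lam k)" using lam_e2_le[OF k] by simp
  finally show ?thesis .
qed

text \<open>Distinct categories contribute at most \<open>(2 * n)^2 * 4 / n^2 = 16\<close>. Equal
  ones contribute at most 8 from \<open>2 * g^2\<close> and \<open>4 * min d n\<close> from the
  minima; \<open>min d n\<close> is at least 1, which gives 28.\<close>

lemma overlap_energy_expectation:
  shows "integrable (measure_pmf F) (overlap_energy n d)"
    and "E (overlap_energy n d) \<le> 28 * real (min d n)"
proof -
  have eq: "overlap_energy n d = (\<lambda>X. \<Sum>i=1..2*n. \<Sum>j\<in>{1..2*n} - {i}. \<Sum>k=1..d. \<Sum>l=1..d. Z i j k X * Z i j l X)"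
    by (rule ext) (simp only: overlap_energy_def off_diag_def overlap_eq power2_eq_square sum_product)
  have iZ: "integrable (measure_pmf F) (\<lambda>X. Z i j k X * Z i j l X)"
    if "i \<in> {1..2*n}" "j \<in> {1..2*n} - {i}" "k \<in> {1..d}" "l \<in> {1..d}" for i j k l
    using Z_product_expectation(1)[of k l i j] Z_square_expectation(2)[of k i j] that by (cases "k = l") auto
  show int: "integrable (measure_pmf F) (overlap_energy n d)"
    unfolding eq by (intro Bochner_Integration.integrable_sum iZ)
  define e where "e i j k l = E (\<lambda>X. Z i j k X * Z i j l X)" for i j k l
  have "E (overlap_energy n d) = (\<Sum>i=1..2*n. \<Sum>j\<in>{1..2*n} - {i}. \<Sum>k=1..d. \<Sum>l=1..d. e i j k l)"
    unfolding eq e_def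
    by (subst Bochner_Integration.integral_sum, intro Bochner_Integration.integrable_sum iZ, assumption+,
        intro sum.cong refl,
        subst Bochner_Integration.integral_sum, intro Bochner_Integration.integrable_sum iZ, assumption+,
        intro sum.cong refl,
        subst Bochner_Integration.integral_sum, intro Bochner_Integration.integrable_sum iZ, assumption+,
        intro sum.cong refl,
        subst Bochner_Integration.integral_sum, intro iZ, assumption+, rule refl)
  also have "\<dots> \<le> (\<Sum>i=1..2*n. \<Sum>j\<in>{1..2*n} - {i}. \<Sum>k=1..d. e i j k k + (\<Sum>l=1..d. g k * g l / (real n)\<^sup>2))"
  proof (intro sum_mono)
    fix i j k assume ij: "i \<in> {1..2*n}" "j \<in> {1..2*n} - {i}" and k: "k \<in> {1..d}"
    have "(\<Sum>l=1..d. e i j k l) = e i j k k + (\<Sum>l\<in>{1..d} - {k}. e i j k l)"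
      using k by (subst sum.remove[of _ k]) auto
    also have "(\<Sum>l\<in>{1..d} - {k}. e i j k l) \<le> (\<Sum>l\<in>{1..d} - {k}. g k * g l / (real n)\<^sup>2)"
      unfolding e_def using ij k by (intro sum_mono Z_product_le) auto
    also have "\<dots> \<le> (\<Sum>l=1..d. g k * g l / (real n)\<^sup>2)"
      by (intro sum_mono2) (auto intro!: divide_nonneg_nonneg mult_nonneg_nonneg g_nonneg)
    finally show "(\<Sum>l=1..d. e i j k l) \<le> e i j k k + (\<Sum>l=1..d. g k * g l / (real n)\<^sup>2)" by simp
  qed
  also have "\<dots> = (\<Sum>i=1..2*n. \<Sum>j\<in>{1..2*n} - {i}. \<Sum>k=1..d. e i j k k)
      + (\<Sum>i=1..2*n. \<Sum>j\<in>{1..2*n} - {i}. 4 / (real n)\<^sup>2)"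
  proof -
    have "(\<Sum>k=1..d. \<Sum>l=1..d. g k * g l / (real n)\<^sup>2) = (\<Sum>k=1..d. g k) * (\<Sum>l=1..d. g l) / (real n)\<^sup>2"
      by (simp only: sum_product sum_divide_distrib)
    then have "(\<Sum>k=1..d. \<Sum>l=1..d. g k * g l / (real n)\<^sup>2) = 4 / (real n)\<^sup>2" unfolding g_sum by simp
    then show ?thesis by (simp only: sum.distrib)
  qed
  also have "(\<Sum>i=1..2*n. \<Sum>j\<in>{1..2*n} - {i}. 4 / (real n)\<^sup>2) \<le> (\<Sum>i=1..2*n. \<Sum>j=1..2*n. 4 / (real n)\<^sup>2)"
    by (intro sum_mono sum_mono2) auto
  also have "\<dots> = 16" using n by (simp add: power2_eq_square)
  also have "(\<Sum>i=1..2*n. \<Sum>j\<in>{1..2*n} - {i}. \<Sum>k=1..d. e i j k k)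
     = (\<Sum>k=1..d. off_diag {1..2*n} (\<lambda>i j. e i j k k))"
    unfolding off_diag_def
    by (rule trans[OF sum.cong[OF refl sum.swap] sum.swap])
  also have "\<dots> \<le> (\<Sum>k=1..d. 2 * (g k)\<^sup>2 + 2 * min 1 (lam k))"
    unfolding e_def by (intro sum_mono Z_square_sum_le)
  also have "\<dots> = 2 * (\<Sum>k=1..d. (g k)\<^sup>2) + 2 * (\<Sum>k=1..d. min 1 (lam k))"
    by (simp only: sum.distrib sum_distrib_left)
  also have "(\<Sum>k=1..d. (g k)\<^sup>2) \<le> (\<Sum>k=1..d. 2 * g k)"
  proof (intro sum_mono)
    fix k assume "k \<in> {1..d}"
    then have "g k \<le> (\<Sum>k=1..d. g k)" by (intro member_le_sum g_nonneg) auto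
    then show "(g k)\<^sup>2 \<le> 2 * g k" unfolding g_sum power2_eq_square by (intro mult_right_mono g_nonneg)
  qed
  also have "(\<Sum>k=1..d. 2 * g k) = 4" unfolding sum_distrib_left[symmetric] g_sum by simp
  finally have "E (overlap_energy n d) \<le> 24 + 2 * (\<Sum>k=1..d. min 1 (lam k))" by simp
  also have "\<dots> \<le> 24 + 4 * real (min d n)" using sum_min_lam by simp
  also have "\<dots> \<le> 28 * real (min d n)" using n d by simp
  finally show "E (overlap_energy n d) \<le> 28 * real (min d n)" .
qed

end

text \<open>
  Unbiased estimators of \<open>(v - w)\<^sup>2\<close> and \<open>(v - w)\<^sup>4\<close> from independent Poisson variables with means
  \<open>v\<close> and \<open>w\<close>: the binomial expansions with powers replaced by falling factorials.
\<close>
definition disc2 :: "real \<Rightarrow> real \<Rightarrow> real" where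
  "disc2 v w = falling 2 v - 2 * (falling 1 v * falling 1 w) + falling 2 w"

definition disc4 :: "real \<Rightarrow> real \<Rightarrow> real" where
  "disc4 v w = falling 4 v - 4 * (falling 3 v * falling 1 w) + 6 * (falling 2 v * falling 2 w)
     - 4 * (falling 1 v * falling 3 w) + falling 4 w"

lemma disc2_eq: "disc2 v w = (v - w)\<^sup>2 - (v + w)"
  by (simp add: disc2_def eval_nat_numeral algebra_simps)

text \<open>Every term on the right is \<open>disc4\<close>, \<open>disc2\<close> or a falling
  factorial of the total, times a function of the total; the second moment of the statistic is thus
  reduced to known moments.\<close>

lemma disc2_square:
  "(disc2 v w)\<^sup>2 = disc4 v w + 4 * ((v + w - 2) * disc2 v w) + 2 * falling 2 (v + w)"
  by (simp add: disc2_def disc4_def eval_nat_numeral algebra_simps)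

section \<open>Moments of the observed statistic\<close>

context two_sample
begin

definition V :: "sample \<Rightarrow> nat \<Rightarrow> nat" where "V X k = (\<Sum>x\<in>{1..n} \<times> {k}. X x)"
definition W :: "sample \<Rightarrow> nat \<Rightarrow> nat" where "W X k = (\<Sum>x\<in>{n+1..2*n} \<times> {k}. X x)"

definition T :: "nat \<Rightarrow> sample \<Rightarrow> real" where
  "T k X = disc2 (real (V X k)) (real (W X k)) / real (N X k)"

definition delta :: "nat \<Rightarrow> real" where "delta k = (real n * (p k - q k))\<^sup>2"

definition mu :: "nat \<Rightarrow> real" where "mu k = delta k * e1 k"

lemma N_V_W: "N X k = V X k + W X k"
proof -
  have "col k = {1..n} \<times> {k} \<union> {n+1..2*n} \<times> {k}" by (auto simp: col_def)
  then show ?thesis unfolding N_def V_def W_def by (simp only:) (rule sum.union_disjoint, auto)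
qed

lemma V_eq: "V X k = (\<Sum>i=1..n. X (i, k))"
proof -
  have "{1..n} \<times> {k} = (\<lambda>i. (i, k)) ` {1..n}" by auto
  then show ?thesis unfolding V_def by (simp add: sum.reindex inj_on_def)
qed

lemma W_eq: "W X k = (\<Sum>i=1..n. X (i + n, k))"
proof -
  have "\<exists>j\<in>{1..n}. i = j + n" if "i \<in> {n+1..2*n}" for i
    using that by (intro bexI[of _ "i - n"]) auto
  then have "{n+1..2*n} \<times> {k} = (\<lambda>i. (i + n, k)) ` {1..n}"
    by (fastforce simp: image_iff)
  then show ?thesis unfolding W_def by (simp add: sum.reindex inj_on_def)
qed

lemma rate_sums:
  "sum rate ({1..n} \<times> {k}) = real n * p k" "sum rate ({n+1..2*n} \<times> {k}) = real n * q k"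
proof -
  have "sum rate ({1..n} \<times> {k}) = (\<Sum>x\<in>{1..n} \<times> {k}. p k)"
    by (intro sum.cong) (auto simp: rate_def)
  then show "sum rate ({1..n} \<times> {k}) = real n * p k" by (simp add: card_cartesian_product)
  have "sum rate ({n+1..2*n} \<times> {k}) = (\<Sum>x\<in>{n+1..2*n} \<times> {k}. q k)"
    by (intro sum.cong) (auto simp: rate_def)
  then show "sum rate ({n+1..2*n} \<times> {k}) = real n * q k" by (simp add: card_cartesian_product)
qed

lemma moment_VW:
  assumes k: "k \<in> {1..d}" and h: "\<And>m. \<bar>h m\<bar> \<le> (K::real)"
  shows "integrable (measure_pmf F) (\<lambda>X. falling j (real (V X k)) * falling l (real (W X k)) * h (N X k))"
    and "E (\<lambda>X. falling j (real (V X k)) * falling l (real (W X k)) * h (N X k))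
      = (real n * p k) ^ j * (real n * q k) ^ l * E (\<lambda>X. h (N X k + j + l))"
proof -
  have s: "{1..n} \<times> {k} \<subseteq> cells" "{n+1..2*n} \<times> {k} \<subseteq> cells" "({1..n} \<times> {k}) \<inter> ({n+1..2*n} \<times> {k}) = {}"
    using k by (auto simp: cells_def)
  show "integrable (measure_pmf F) (\<lambda>X. falling j (real (V X k)) * falling l (real (W X k)) * h (N X k))"
    and "E (\<lambda>X. falling j (real (V X k)) * falling l (real (W X k)) * h (N X k))
      = (real n * p k) ^ j * (real n * q k) ^ l * E (\<lambda>X. h (N X k + j + l))"
    unfolding N_V_W V_def W_def using factorial_moment[OF s, of h K j l, OF h] unfolding rate_sums by blast+
qed

text \<open>All three monomials have total degree 2 and shift \<open>N\<close> by the same amount,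
  so the expectation of \<open>h\<close> factors out and the binomial expansion of
  \<open>delta k\<close> remains. The same holds in degree 4 for \<open>disc4\<close>.\<close>

lemma moment_disc2:
  assumes k: "k \<in> {1..d}" and h: "\<And>m. \<bar>h m\<bar> \<le> (K::real)"
  shows "integrable (measure_pmf F) (\<lambda>X. disc2 (real (V X k)) (real (W X k)) * h (N X k))"
    and "E (\<lambda>X. disc2 (real (V X k)) (real (W X k)) * h (N X k)) = delta k * E (\<lambda>X. h (N X k + 2))"
proof -
  note m = moment_VW[of k h, OF k h]
  have eq: "disc2 (real (V X k)) (real (W X k)) * h (N X k)
    = falling 2 (real (V X k)) * falling 0 (real (W X k)) * h (N X k)
      - 2 * (falling 1 (real (V X k)) * falling 1 (real (W X k)) * h (N X k))
      + falling 0 (real (V X k)) * falling 2 (real (W X k)) * h (N X k)" for X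
    by (simp add: disc2_def algebra_simps)
  show "integrable (measure_pmf F) (\<lambda>X. disc2 (real (V X k)) (real (W X k)) * h (N X k))"
    unfolding eq by (intro Bochner_Integration.integrable_add Bochner_Integration.integrable_diff integrable_mult_right m(1))
  have "E (\<lambda>X. disc2 (real (V X k)) (real (W X k)) * h (N X k))
    = E (\<lambda>X. falling 2 (real (V X k)) * falling 0 (real (W X k)) * h (N X k))
      - 2 * E (\<lambda>X. falling 1 (real (V X k)) * falling 1 (real (W X k)) * h (N X k))
      + E (\<lambda>X. falling 0 (real (V X k)) * falling 2 (real (W X k)) * h (N X k))"
    unfolding eq
    by (subst Bochner_Integration.integral_add Bochner_Integration.integral_diff integral_mult_right_zero,
        (intro Bochner_Integration.integrable_add Bochner_Integration.integrable_diff integrable_mult_right m(1))+)+ simp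
  also have "\<dots> = delta k * E (\<lambda>X. h (N X k + 2))"
    unfolding m(2) delta_def by (simp add: power2_eq_square algebra_simps)
  finally show "E (\<lambda>X. disc2 (real (V X k)) (real (W X k)) * h (N X k)) = delta k * E (\<lambda>X. h (N X k + 2))" .
qed

lemma moment_disc4:
  assumes k: "k \<in> {1..d}" and h: "\<And>m. \<bar>h m\<bar> \<le> (K::real)"
  shows "integrable (measure_pmf F) (\<lambda>X. disc4 (real (V X k)) (real (W X k)) * h (N X k))"
    and "E (\<lambda>X. disc4 (real (V X k)) (real (W X k)) * h (N X k)) = (delta k)\<^sup>2 * E (\<lambda>X. h (N X k + 4))"
proof -
  note m = moment_VW[of k h, OF k h]
  define t where "t j l X = falling j (real (V X k)) * falling l (real (W X k)) * h (N X k)" for j l X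
  have it: "integrable (measure_pmf F) (t j l)" for j l unfolding t_def by (rule m(1))
  have et: "E (t j l) = (real n * p k) ^ j * (real n * q k) ^ l * E (\<lambda>X. h (N X k + j + l))" for j l
    unfolding t_def by (rule m(2))
  have eq: "disc4 (real (V X k)) (real (W X k)) * h (N X k)
    = t 4 0 X - 4 * t 3 1 X + 6 * t 2 2 X - 4 * t 1 3 X + t 0 4 X" for X
    by (simp add: disc4_def t_def algebra_simps del: falling.simps(2))
  show "integrable (measure_pmf F) (\<lambda>X. disc4 (real (V X k)) (real (W X k)) * h (N X k))"
    unfolding eq by (intro Bochner_Integration.integrable_add Bochner_Integration.integrable_diff integrable_mult_right it)
  have "E (\<lambda>X. disc4 (real (V X k)) (real (W X k)) * h (N X k))
    = E (t 4 0) - 4 * E (t 3 1) + 6 * E (t 2 2) - 4 * E (t 1 3) + E (t 0 4)"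
    unfolding eq using it by simp
  also have "\<dots> = (delta k)\<^sup>2 * E (\<lambda>X. h (N X k + 4))"
    unfolding et delta_def by (simp add: eval_nat_numeral algebra_simps)
  finally show "E (\<lambda>X. disc4 (real (V X k)) (real (W X k)) * h (N X k)) = (delta k)\<^sup>2 * E (\<lambda>X. h (N X k + 4))" .
qed

lemma T_expectation:
  assumes k: "k \<in> {1..d}"
  shows "integrable (measure_pmf F) (T k)" "E (T k) = mu k"
  using moment_disc2[of k "\<lambda>m. 1 / real m", OF k inv_bounds(5)]
  unfolding T_def[abs_def] mu_def e1_def by (simp_all add: add.commute)

lemma delta_le: "delta k \<le> (lam k)\<^sup>2" and delta_nonneg: "0 \<le> delta k"
proof -
  have "\<bar>real n * (p k - q k)\<bar> \<le> \<bar>lam k\<bar>"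
    unfolding lam_def g_def abs_mult using p_nonneg[of k] q_nonneg[of k]
    by (intro mult_left_mono) auto
  then show "delta k \<le> (lam k)\<^sup>2" unfolding delta_def by (rule power2_le_iff_abs_le[THEN iffD2, OF abs_ge_zero, unfolded power2_abs])
qed (simp add: delta_def)

definition e4 :: "nat \<Rightarrow> real" where "e4 k = E (\<lambda>X. 1 / (real (N X k) + 4)\<^sup>2)"

lemma lam_e4_le: assumes k: "k \<in> {1..d}" shows "(lam k)\<^sup>2 * e4 k \<le> 1"
proof -
  have "(lam k)\<^sup>2 * e4 k \<le> (lam k)\<^sup>2 * e2 k"
    unfolding e4_def e2_def
  proof (intro mult_left_mono integral_mono)
    show "integrable (measure_pmf F) (\<lambda>X. 1 / (real (N X k) + 2)\<^sup>2)"
      by (rule integrable_N[of "\<lambda>m. 1 / (real m + 2)\<^sup>2", OF inv_bounds(4)])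
    have b: "\<bar>1 / (real m + 4)\<^sup>2\<bar> \<le> 1 / (4::real)" for m
    proof -
      have "2\<^sup>2 \<le> (real m + 4)\<^sup>2" by (intro power_mono) auto
      then show ?thesis by (simp add: field_simps)
    qed
    show "integrable (measure_pmf F) (\<lambda>X. 1 / (real (N X k) + 4)\<^sup>2)"
      by (rule integrable_N[of "\<lambda>m. 1 / (real m + 4)\<^sup>2", OF b])
    show "1 / (real (N X k) + 4)\<^sup>2 \<le> 1 / (real (N X k) + 2)\<^sup>2" for X
      by (intro divide_left_mono power_mono mult_pos_pos) auto
  qed auto
  also have "\<dots> \<le> 1" using lam_e2_le[OF k] by simp
  finally show ?thesis .
qed

text \<open>The leading orders cancel. With \<open>L = lam k\<close>, the bounds
  \<open>L^2 * e4 \<le> 1\<close> and \<open>L * e1 \<ge> L / (L + 2)\<close> give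
  \<open>L^2 * (e4 - e1^2) \<le> 4 / (L + 2) \<le> 4 * e1\<close>; then
  \<open>delta k \<le> L^2\<close> and one more factor \<open>delta k\<close> finish.\<close>

lemma delta_e4_le: assumes k: "k \<in> {1..d}" shows "(delta k)\<^sup>2 * e4 k - (mu k)\<^sup>2 \<le> 4 * mu k"
proof -
  define L where "L = lam k"
  have L: "0 \<le> L" "L\<^sup>2 * e4 k \<le> 1" "1 / (L + 2) \<le> e1 k" "delta k \<le> L\<^sup>2"
    using lam_nonneg[of k] lam_e4_le[OF k] e1_ge[OF k] delta_le[of k] by (auto simp: L_def)
  have "(L / (L + 2))\<^sup>2 \<le> (L * e1 k)\<^sup>2"
    using mult_left_mono[OF L(3,1)] L(1) by (intro power_mono) auto
  then have "L\<^sup>2 * (e4 k - (e1 k)\<^sup>2) \<le> 1 - (L / (L + 2))\<^sup>2"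
    using L(2) by (simp add: right_diff_distrib power_mult_distrib)
  also have "\<dots> = ((L + 2)\<^sup>2 - L\<^sup>2) / (L + 2)\<^sup>2" using L(1) by (simp add: diff_divide_distrib power_divide)
  also have "\<dots> \<le> (4 * L + 8) / (L + 2)\<^sup>2"
    by (intro divide_right_mono zero_le_power2) (simp add: power2_eq_square algebra_simps)
  also have "\<dots> = 4 * (L + 2) / (L + 2)\<^sup>2" by simp
  also have "\<dots> = 4 * ((L + 2) / (L + 2)\<^sup>2)" by (rule times_divide_eq_right[symmetric])
  also have "(L + 2) / (L + 2)\<^sup>2 = 1 / (L + 2)" using L(1) by (simp add: power2_eq_square)
  also have "4 * (1 / (L + 2)) \<le> 4 * e1 k" using L(3) by simp
  finally have *: "L\<^sup>2 * (e4 k - (e1 k)\<^sup>2) \<le> 4 * e1 k" .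
  have "delta k * (e4 k - (e1 k)\<^sup>2) \<le> 4 * e1 k"
  proof (cases "e4 k - (e1 k)\<^sup>2 \<le> 0")
    case True
    then have "delta k * (e4 k - (e1 k)\<^sup>2) \<le> 0" using delta_nonneg by (simp add: mult_nonneg_nonpos)
    then show ?thesis using e1_nonneg[of k] by linarith
  next
    case False
    then have "delta k * (e4 k - (e1 k)\<^sup>2) \<le> L\<^sup>2 * (e4 k - (e1 k)\<^sup>2)" using L(4) by (intro mult_right_mono) auto
    then show ?thesis using * by linarith
  qed
  then have "delta k * (delta k * (e4 k - (e1 k)\<^sup>2)) \<le> delta k * (4 * e1 k)"
    by (intro mult_left_mono delta_nonneg)
  then show ?thesis by (simp add: mu_def power2_eq_square algebra_simps)
qed

text \<open>The \<open>disc4\<close> part gives \<open>(mu k)^2 + 4 * mu k\<close>, the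
  \<open>disc2\<close> part another \<open>4 * mu k\<close>, and the falling factorial twice the
  minimum.\<close>

lemma T_second_moment:
  assumes k: "k \<in> {1..d}"
  shows "integrable (measure_pmf F) (\<lambda>X. (T k X)\<^sup>2)"
    and "E (\<lambda>X. (T k X)\<^sup>2) \<le> (mu k)\<^sup>2 + 8 * mu k + 2 * min 1 (lam k)"
proof -
  define A where "A X = disc4 (real (V X k)) (real (W X k)) * (1 / (real (N X k))\<^sup>2)" for X
  define B where "B X = disc2 (real (V X k)) (real (W X k)) * ((real (N X k) - 2) / (real (N X k))\<^sup>2)" for X
  define C where "C X = falling 2 (real (N X k)) * (1 / (real (N X k))\<^sup>2)" for X
  have b: "\<bar>(real m - 2) / (real m)\<^sup>2\<bar> \<le> 1" for m
  proof (cases "m = 0")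
    case False
    have "\<bar>real m - 2\<bar> \<le> real m" using False by (cases "m = 1") (auto simp: abs_le_iff)
    also have "\<dots> \<le> (real m)\<^sup>2" using False by (simp add: power2_eq_square)
    finally show ?thesis using False by (simp add: abs_divide)
  qed simp
  note mA = moment_disc4[of k "\<lambda>m. 1 / (real m)\<^sup>2", OF k inv_bounds(3), folded A_def]
  note mB = moment_disc2[of k "\<lambda>m. (real m - 2) / (real m)\<^sup>2", OF k b, folded B_def]
  note mC = moment_N[of k "\<lambda>m. 1 / (real m)\<^sup>2" 1 2, OF k inv_bounds(3), folded C_def]
  have eq: "(T k X)\<^sup>2 = A X + 4 * B X + 2 * C X" for X
    unfolding T_def power_divide disc2_square A_def B_def C_def
    by (simp add: N_V_W add_divide_distrib)
  show "integrable (measure_pmf F) (\<lambda>X. (T k X)\<^sup>2)"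
    unfolding eq by (intro Bochner_Integration.integrable_add integrable_mult_right mA(1) mB(1) mC(1))
  have "E (\<lambda>X. (T k X)\<^sup>2) = E A + 4 * E B + 2 * E C"
    unfolding eq using mA(1) mB(1) mC(1) by simp
  also have "E A = (delta k)\<^sup>2 * e4 k" using mA(2) by (simp add: e4_def add.commute)
  also have "E B \<le> mu k"
  proof -
    have "E (\<lambda>X. (real (N X k + 2) - 2) / (real (N X k + 2))\<^sup>2) \<le> e1 k"
      unfolding e1_def
    proof (rule integral_mono)
      have "\<bar>(real (m + 2) - 2) / (real (m + 2))\<^sup>2\<bar> \<le> 1" for m by (rule b)
      then show "integrable (measure_pmf F) (\<lambda>X. (real (N X k + 2) - 2) / (real (N X k + 2))\<^sup>2)"
        by (rule integrable_N[of "\<lambda>m. (real (m + 2) - 2) / (real (m + 2))\<^sup>2"])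
      show "integrable (measure_pmf F) (\<lambda>X. 1 / (real (N X k) + 2))"
        by (rule integrable_N[of "\<lambda>m. 1 / (real m + 2)", OF inv_bounds(2)])
      show "(real (N X k + 2) - 2) / (real (N X k + 2))\<^sup>2 \<le> 1 / (real (N X k) + 2)" for X
      proof -
        have "(real (N X k + 2) - 2) / (real (N X k + 2))\<^sup>2 \<le> real (N X k + 2) / (real (N X k + 2))\<^sup>2"
          by (intro divide_right_mono) auto
        also have "\<dots> = 1 / (real (N X k) + 2)" by (simp add: power2_eq_square)
        finally show ?thesis .
      qed
    qed
    then show ?thesis unfolding mB(2) mu_def by (intro mult_left_mono delta_nonneg)
  qed
  also have "E C = (lam k)\<^sup>2 * e2 k" using mC(2) by (simp add: e2_def add.commute)
  finally show "E (\<lambda>X. (T k X)\<^sup>2) \<le> (mu k)\<^sup>2 + 8 * mu k + 2 * min 1 (lam k)"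
    using delta_e4_le[OF k] lam_e2_le[OF k] by linarith
qed

text \<open>The two terms depend on disjoint blocks of independent cells. The auxiliary \<phi>
  writes each as a measurable function of the sample restricted to its own column.\<close>

lemma T_uncorrelated:
  assumes k: "k \<in> {1..d}" and l: "l \<in> {1..d}" and kl: "k \<noteq> l"
  shows "integrable (measure_pmf F) (\<lambda>X. T k X * T l X)" and "E (\<lambda>X. T k X * T l X) = mu k * mu l"
proof -
  define \<phi> where "\<phi> k X = disc2 (\<Sum>x\<in>{1..n} \<times> {k}. real (X x)) (\<Sum>x\<in>{n+1..2*n} \<times> {k}. real (X x))
     / ((\<Sum>x\<in>{1..n} \<times> {k}. real (X x)) + (\<Sum>x\<in>{n+1..2*n} \<times> {k}. real (X x)))" for k and X :: sample
  have phi: "\<phi> k (restrict X (col k)) = T k X" for k X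
  proof -
    have "(\<Sum>x\<in>A. real (restrict X (col k) x)) = (\<Sum>x\<in>A. real (X x))" if "A \<subseteq> col k" for A
      using that by (intro sum.cong) auto
    moreover have "{1..n} \<times> {k} \<subseteq> col k" "{n+1..2*n} \<times> {k} \<subseteq> col k" by (auto simp: col_def)
    ultimately show ?thesis unfolding \<phi>_def T_def N_V_W V_def W_def by (simp only: of_nat_add of_nat_sum)
  qed
  have meas: "\<phi> k \<in> borel_measurable (PiM (col k) (\<lambda>_. count_space UNIV))" for k
  proof -
    have [measurable]: "(\<lambda>X. real (X x)) \<in> borel_measurable (PiM (col k) (\<lambda>_. count_space UNIV))" if "x \<in> col k" for x
    proof -
      have "(\<lambda>X. X x) \<in> measurable (PiM (col k) (\<lambda>_. count_space UNIV)) (count_space UNIV)"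
        using that by (rule measurable_component_singleton)
      then show ?thesis by (rule measurable_compose) simp
    qed
    have s: "(\<lambda>X. \<Sum>x\<in>A. real (X x)) \<in> borel_measurable (PiM (col k) (\<lambda>_. count_space UNIV))" if "A \<subseteq> col k" for A
      using that by (intro borel_measurable_sum) auto
    have [measurable]: "(\<lambda>X. \<Sum>x\<in>{1..n} \<times> {k}. real (X x)) \<in> borel_measurable (PiM (col k) (\<lambda>_. count_space UNIV))"
      "(\<lambda>X. \<Sum>x\<in>{n+1..2*n} \<times> {k}. real (X x)) \<in> borel_measurable (PiM (col k) (\<lambda>_. count_space UNIV))"
      by (rule s, force simp: col_def)+
    show ?thesis unfolding \<phi>_def disc2_eq by measurable
  qed
  have "prob_space.indep_vars (measure_pmf F) (\<lambda>_. count_space UNIV) (\<lambda>x X. X x) cells"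
    unfolding F_def by (rule indep_vars_Pi_pmf[OF fin])
  then have "prob_space.indep_var (measure_pmf F) (PiM (col k) (\<lambda>_. count_space UNIV)) (\<lambda>X. restrict (\<lambda>x. X x) (col k))
     (PiM (col l) (\<lambda>_. count_space UNIV)) (\<lambda>X. restrict (\<lambda>x. X x) (col l))"
    by (rule prob_space.indep_var_restrict[OF measure_pmf.prob_space_axioms]) (use kl col_subset k l in \<open>auto simp: col_def\<close>)
  from prob_space.indep_var_compose[OF measure_pmf.prob_space_axioms this meas meas]
  have "prob_space.indep_var (measure_pmf F) borel (T k) borel (T l)"
    by (simp add: o_def phi)
  note ind = measure_pmf.prob_space_axioms this T_expectation(1)[OF k] T_expectation(1)[OF l]
  show "integrable (measure_pmf F) (\<lambda>X. T k X * T l X)"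
    by (rule prob_space.indep_var_integrable[OF ind])
  show "E (\<lambda>X. T k X * T l X) = mu k * mu l"
    using prob_space.indep_var_lebesgue_integral[OF ind] by (simp only: T_expectation(2)[OF k] T_expectation(2)[OF l])
qed

definition Mu :: real where "Mu = (\<Sum>k=1..d. mu k)"

lemma stat_variance:
  shows "integrable (measure_pmf F) (\<lambda>X. ((\<Sum>k=1..d. T k X) - Mu)\<^sup>2)"
    and "E (\<lambda>X. ((\<Sum>k=1..d. T k X) - Mu)\<^sup>2) \<le> 8 * Mu + 4 * real (min d n)"
proof -
  define c where "c k l X = (T k X - mu k) * (T l X - mu l)" for k l X
  have eq: "((\<Sum>k=1..d. T k X) - Mu)\<^sup>2 = (\<Sum>k=1..d. \<Sum>l=1..d. c k l X)" for X
    unfolding c_def Mu_def sum_subtractf[symmetric] power2_eq_square sum_product ..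
  have c_eq: "c k l X = T k X * T l X - mu k * T l X - mu l * T k X + mu k * mu l" for k l X
    by (simp add: c_def algebra_simps)
  have iT: "integrable (measure_pmf F) (\<lambda>X. T k X * T l X)" if "k \<in> {1..d}" "l \<in> {1..d}" for k l
    using T_uncorrelated(1)[OF that] T_second_moment(1)[OF that(1)] by (cases "k = l") (auto simp: power2_eq_square)
  have ic: "integrable (measure_pmf F) (c k l)" if "k \<in> {1..d}" "l \<in> {1..d}" for k l
    unfolding c_eq[abs_def] using iT[OF that] T_expectation(1) that by auto
  have Ec: "E (c k l) = E (\<lambda>X. T k X * T l X) - mu k * mu l" if "k \<in> {1..d}" "l \<in> {1..d}" for k l
    unfolding c_eq[abs_def] using iT[OF that] T_expectation(1)[OF that(1)] T_expectation(1)[OF that(2)]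
      T_expectation(2)[OF that(1)] T_expectation(2)[OF that(2)] by simp
  show "integrable (measure_pmf F) (\<lambda>X. ((\<Sum>k=1..d. T k X) - Mu)\<^sup>2)"
    unfolding eq by (intro Bochner_Integration.integrable_sum ic)
  have "E (\<lambda>X. ((\<Sum>k=1..d. T k X) - Mu)\<^sup>2) = (\<Sum>k=1..d. \<Sum>l=1..d. E (c k l))"
    unfolding eq
    by (subst Bochner_Integration.integral_sum, intro Bochner_Integration.integrable_sum ic, assumption+,
        intro sum.cong refl, subst Bochner_Integration.integral_sum, intro ic, assumption+, rule refl)
  also have "\<dots> = (\<Sum>k=1..d. E (c k k))"
  proof (intro sum.cong refl)
    fix k assume k: "k \<in> {1..d}"
    have "(\<Sum>l=1..d. E (c k l)) = E (c k k) + (\<Sum>l\<in>{1..d} - {k}. E (c k l))"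
      using k by (intro sum.remove) auto
    also have "(\<Sum>l\<in>{1..d} - {k}. E (c k l)) = 0"
      using k Ec T_uncorrelated(2) by (intro sum.neutral) auto
    finally show "(\<Sum>l=1..d. E (c k l)) = E (c k k)" by simp
  qed
  also have "\<dots> \<le> (\<Sum>k=1..d. 8 * mu k + 2 * min 1 (lam k))"
  proof (intro sum_mono)
    fix k assume k: "k \<in> {1..d}"
    show "E (c k k) \<le> 8 * mu k + 2 * min 1 (lam k)"
      unfolding Ec[OF k k] using T_second_moment(2)[OF k] by (simp add: power2_eq_square)
  qed
  also have "\<dots> = 8 * Mu + 2 * (\<Sum>k=1..d. min 1 (lam k))"
    by (simp only: sum.distrib sum_distrib_left Mu_def)
  also have "\<dots> \<le> 8 * Mu + 4 * real (min d n)" using sum_min_lam by simp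
  finally show "E (\<lambda>X. ((\<Sum>k=1..d. T k X) - Mu)\<^sup>2) \<le> 8 * Mu + 4 * real (min d n)" .
qed

text \<open>Cauchy-Schwarz with weights \<open>lam k + 2\<close>, whose total is
  \<open>2 * (n + d)\<close>; they are the reciprocals of the Jensen bounds on
  \<open>e1 k\<close>.\<close>

lemma Mu_ge: "(real n * (\<Sum>k=1..d. \<bar>p k - q k\<bar>))\<^sup>2 / (2 * (real n + real d)) \<le> Mu"
proof -
  define u where "u k = real n * \<bar>p k - q k\<bar> / sqrt (lam k + 2)" for k
  define w where "w k = sqrt (lam k + 2)" for k
  have pos: "0 < lam k + 2" for k using lam_nonneg[of k] by simp
  have "(\<Sum>k=1..d. u k * w k)\<^sup>2 \<le> (\<Sum>k=1..d. (u k)\<^sup>2) * (\<Sum>k=1..d. (w k)\<^sup>2)"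
    by (rule Cauchy_Schwarz_ineq_sum)
  also have "(\<Sum>k=1..d. u k * w k) = real n * (\<Sum>k=1..d. \<bar>p k - q k\<bar>)"
    unfolding sum_distrib_left u_def w_def using pos by (intro sum.cong refl) (simp add: less_imp_neq[OF pos, symmetric])
  also have "(\<Sum>k=1..d. (w k)\<^sup>2) = 2 * (real n + real d)"
  proof -
    have "(\<Sum>k=1..d. (w k)\<^sup>2) = (\<Sum>k=1..d. lam k + 2)"
      unfolding w_def using pos by (intro sum.cong refl) (simp add: less_imp_le)
    also have "\<dots> = real n * (\<Sum>k=1..d. g k) + 2 * real d" by (simp add: sum.distrib lam_def sum_distrib_left)
    finally show ?thesis unfolding g_sum by simp
  qed
  also have "(\<Sum>k=1..d. (u k)\<^sup>2) \<le> Mu" unfolding Mu_def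
  proof (intro sum_mono)
    fix k assume k: "k \<in> {1..d}"
    have "(u k)\<^sup>2 = delta k * (1 / (lam k + 2))"
      using pos[of k] by (simp add: u_def delta_def power_divide power_mult_distrib)
    also have "\<dots> \<le> mu k" unfolding mu_def by (intro mult_left_mono e1_ge k delta_nonneg)
    finally show "(u k)\<^sup>2 \<le> mu k" .
  qed
  finally have "(real n * (\<Sum>k=1..d. \<bar>p k - q k\<bar>))\<^sup>2 \<le> Mu * (2 * (real n + real d))"
    by (simp add: mult_right_mono)
  then show ?thesis using n by (simp add: divide_le_eq)
qed

section \<open>Power when the mean is large\<close>

lemma markov:
  assumes "integrable (measure_pmf F) u" "\<And>X. 0 \<le> (u X :: real)" "0 < c"
  shows "measure_pmf.prob F {X. u X \<ge> c} \<le> E u / c"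
  using integral_Markov_inequality_measure[of "measure_pmf F" u UNIV c] assms by simp

lemma perm_stat_id: "perm_stat n d X id = (\<Sum>k=1..d. T k X)"
proof -
  have "((\<Sum>i=1..n. real (X (i, k)) - real (X (i + n, k)))\<^sup>2 - real (N X k)) / real (N X k) = T k X" for k
    unfolding T_def disc2_eq N_V_W V_eq W_eq by (simp add: sum_subtractf)
  then show ?thesis by (simp add: perm_stat_def col_sum_N)
qed

text \<open>Outside three exceptional events the statistic exceeds \<open>Mu / 2\<close>, while
  diagonal part and chaos together keep the critical value below \<open>Mu / 2\<close>.\<close>

lemma power_bound:
  assumes \<alpha>: "0 < \<alpha>" "\<alpha> < exp (-1)" and \<beta>: "0 < \<beta>" "\<beta> < 1"
    and M: "2500 * ln (1 / \<alpha>) * sqrt (real (min d n)) / \<beta>\<^sup>2 \<le> Mu"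
  shows "measure_pmf.prob F {X. perm_stat n d X id \<le> crit_value n d \<alpha> X} \<le> \<beta>"
proof -
  define L where "L = ln (1 / \<alpha>)"
  define m where "m = real (min d n)"
  have m: "1 \<le> m" using n d by (simp add: m_def)
  have L: "1 < L" using \<alpha> unfolding L_def
    by (simp add: ln_div) (metis exp_less_cancel_iff exp_ln minus_less_iff)
  have Mle: "2500 * L * sqrt m / \<beta>\<^sup>2 \<le> Mu" using M by (simp add: L_def m_def)
  have "0 < 2500 * L * sqrt m / \<beta>\<^sup>2" using L m \<beta> by simp
  then have Mpos: "0 < Mu" using Mle by linarith
  define A1 where "A1 = {X. ((\<Sum>k=1..d. T k X) - Mu)\<^sup>2 \<ge> (Mu / 2)\<^sup>2}"
  define A2 where "A2 = {X. diag_part n d X \<ge> Mu / 4}"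
  define A3 where "A3 = {X. overlap_energy n d X \<ge> (Mu / (64 * L))\<^sup>2}"
  have sub: "{X. perm_stat n d X id \<le> crit_value n d \<alpha> X} \<subseteq> A1 \<union> (A2 \<union> A3)"
  proof (rule subsetI, rule ccontr)
    fix X assume X: "X \<in> {X. perm_stat n d X id \<le> crit_value n d \<alpha> X}" and nX: "X \<notin> A1 \<union> (A2 \<union> A3)"
    \<comment> \<open>Chosen so that \<open>8 * L * R = Mu / 4\<close>. The threshold in
      \<open>A3\<close> is \<open>(R / 2)^2\<close>, as four times the energy must not exceed
      \<open>R^2\<close>.\<close>
    define R where "R = Mu / (32 * L)"
    have R: "0 < R" using Mpos L by (simp add: R_def)
    have "4 * overlap_energy n d X \<le> 4 * (Mu / (64 * L))\<^sup>2" using nX by (simp add: A3_def)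
    also have "\<dots> = R\<^sup>2" by (simp add: R_def power_divide power_mult_distrib)
    finally have "crit_value n d \<alpha> X \<le> diag_part n d X + 8 * L * R"
      unfolding L_def by (rule crit_value_le[OF \<alpha> R])
    also have "8 * L * R = Mu / 4" using L by (simp add: R_def)
    also have "diag_part n d X + Mu / 4 < Mu / 2" using nX by (simp add: A2_def)
    finally have "(\<Sum>k=1..d. T k X) < Mu / 2" using X by (simp add: perm_stat_id)
    then have "(Mu / 2)\<^sup>2 \<le> (Mu - (\<Sum>k=1..d. T k X))\<^sup>2" using Mpos by (intro power_mono) auto
    then show False using nX by (simp add: A1_def power2_commute)
  qed
  have r: "1 / Mu \<le> \<beta> / 2500"
  proof -
    have s: "1 \<le> sqrt m" using m by simp
    have "2500 / \<beta> \<le> 2500 / \<beta>\<^sup>2" using \<beta> by (simp add: field_simps power2_eq_square)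
    also have "\<dots> \<le> 2500 * L * sqrt m / \<beta>\<^sup>2"
      using mult_mono[of 1 L 1 "sqrt m"] L s by (intro divide_right_mono) auto
    finally have "2500 / \<beta> \<le> Mu" using Mle by linarith
    then show ?thesis using \<beta> Mpos by (simp add: field_simps)
  qed
  have r2: "m * L\<^sup>2 / Mu\<^sup>2 \<le> \<beta> / 6250000"
  proof -
    have "(2500 * L * sqrt m / \<beta>\<^sup>2)\<^sup>2 \<le> Mu\<^sup>2" using Mle L m by (intro power_mono) auto
    then have "6250000 * (m * L\<^sup>2) \<le> Mu\<^sup>2 * (\<beta>\<^sup>2)\<^sup>2"
      using m \<beta> by (simp add: power_divide power_mult_distrib divide_le_eq mult_ac)
    also have "(\<beta>\<^sup>2)\<^sup>2 \<le> \<beta>"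
    proof -
      have "\<beta> ^ 4 \<le> \<beta> ^ 1" using \<beta> by (intro power_decreasing) auto
      then show ?thesis by (simp flip: power_mult)
    qed
    finally have "6250000 * (m * L\<^sup>2) \<le> Mu\<^sup>2 * \<beta>" by (simp add: mult_left_mono)
    then show ?thesis using Mpos by (simp add: divide_le_eq field_simps)
  qed
  have r3: "m / Mu\<^sup>2 \<le> m * L\<^sup>2 / Mu\<^sup>2"
    using L m mult_left_mono[of 1 "L\<^sup>2" m] by (intro divide_right_mono) auto
  have "measure_pmf.prob F A1 \<le> E (\<lambda>X. ((\<Sum>k=1..d. T k X) - Mu)\<^sup>2) / (Mu / 2)\<^sup>2"
    unfolding A1_def using Mpos by (intro markov stat_variance) auto
  also have "\<dots> \<le> (8 * Mu + 4 * m) / (Mu / 2)\<^sup>2"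
    using stat_variance(2) unfolding m_def by (intro divide_right_mono) auto
  also have "\<dots> = 32 * (1 / Mu) + 16 * (m / Mu\<^sup>2)"
    using Mpos by (simp add: power2_eq_square add_divide_distrib)
  finally have p1: "measure_pmf.prob F A1 \<le> 32 * (1 / Mu) + 16 * (m / Mu\<^sup>2)" .
  have "measure_pmf.prob F A2 \<le> E (diag_part n d) / (Mu / 4)"
    unfolding A2_def using Mpos by (intro markov diag_part_expectation diag_part_nonneg) auto
  also have "\<dots> \<le> 2 / (Mu / 4)" using Mpos diag_part_expectation(2) by (intro divide_right_mono) auto
  finally have p2: "measure_pmf.prob F A2 \<le> 8 * (1 / Mu)" by simp
  have en: "0 \<le> overlap_energy n d X" for X
    unfolding overlap_energy_def by (intro off_diag_nonneg) auto
  have "measure_pmf.prob F A3 \<le> E (overlap_energy n d) / (Mu / (64 * L))\<^sup>2"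
    unfolding A3_def using Mpos L by (intro markov overlap_energy_expectation en) auto
  also have "\<dots> \<le> 28 * m / (Mu / (64 * L))\<^sup>2"
    using overlap_energy_expectation(2) unfolding m_def by (intro divide_right_mono) auto
  \<comment> \<open>\<open>114688 = 28 * 64^2\<close>.\<close>
  also have "\<dots> = 114688 * (m * L\<^sup>2 / Mu\<^sup>2)" by (simp add: power_divide power_mult_distrib)
  finally have p3: "measure_pmf.prob F A3 \<le> 114688 * (m * L\<^sup>2 / Mu\<^sup>2)" .
  have "measure_pmf.prob F {X. perm_stat n d X id \<le> crit_value n d \<alpha> X} \<le> measure_pmf.prob F (A1 \<union> (A2 \<union> A3))"
    by (intro measure_pmf.finite_measure_mono sub) auto
  also have "\<dots> \<le> measure_pmf.prob F A1 + measure_pmf.prob F (A2 \<union> A3)"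
    by (rule measure_Un_le) auto
  also have "measure_pmf.prob F (A2 \<union> A3) \<le> measure_pmf.prob F A2 + measure_pmf.prob F A3"
    by (rule measure_Un_le) auto
  finally have p: "measure_pmf.prob F {X. perm_stat n d X id \<le> crit_value n d \<alpha> X}
    \<le> measure_pmf.prob F A1 + (measure_pmf.prob F A2 + measure_pmf.prob F A3)" by simp
  \<comment> \<open>The total is at most \<open>(40 / 2500 + 114704 / 6250000) * \<beta>\<close>,
    less than \<open>0.035 * \<beta>\<close>.\<close>
  have "P \<le> \<beta>" if "P \<le> p1 + (p2 + p3)" "p1 \<le> 32 * x + 16 * y" "p2 \<le> 8 * x" "p3 \<le> 114688 * z"
      "x \<le> \<beta> / 2500" "z \<le> \<beta> / 6250000" "y \<le> z" for P p1 p2 p3 x y z :: real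
    using that \<beta>(1) by (simp add: field_simps)
  from this[OF p p1 p2 p3 r r2 r3] show ?thesis .
qed

text \<open>For \<open>d \<le> n\<close> the second entry of the maximum is used and
  \<open>n + d \<le> 2 * n\<close>; otherwise the first entry and \<open>n + d \<le> 2 * d\<close>.
  Either way a quarter of \<open>sqrt (min d n)\<close> results, and
  \<open>100^2 / 4 = 2500\<close>.\<close>

lemma Mu_large:
  assumes L: "0 \<le> L" and \<beta>: "0 < \<beta>"
    and \<epsilon>: "100 / \<beta> * sqrt L * max (real d powr (1/2) / real n powr (3/4)) (real d powr (1/4) / real n powr (1/2)) \<le> \<epsilon>"
    and sep: "\<epsilon> \<le> (\<Sum>k=1..d. \<bar>p k - q k\<bar>)"
  shows "2500 * L * sqrt (real (min d n)) / \<beta>\<^sup>2 \<le> Mu"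
proof -
  define D where "D = real d"
  define n' where "n' = real n"
  have Dn: "1 \<le> D" "1 \<le> n'" using n d by (auto simp: D_def n'_def)
  define r where "r = max (D powr (1/2) / n' powr (3/4)) (D powr (1/4) / n' powr (1/2))"
  have r0: "0 \<le> r" unfolding r_def by (auto simp: le_max_iff_disj)
  have sq1: "(D powr (1/2) / n' powr (3/4))\<^sup>2 = D / (n' * sqrt n')"
  proof -
    have "(n' powr (3/4))\<^sup>2 = n' powr (1 + 1/2)" by (simp add: power2_eq_square flip: powr_add)
    also have "\<dots> = n' * sqrt n'" using Dn by (subst powr_add) (simp add: powr_half_sqrt)
    finally show ?thesis using Dn by (simp add: power_divide powr_half_sqrt)
  qed
  have sq2: "(D powr (1/4) / n' powr (1/2))\<^sup>2 = sqrt D / n'"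
  proof -
    have "(D powr (1/4))\<^sup>2 = sqrt D" using Dn by (simp add: power2_eq_square powr_half_sqrt flip: powr_add)
    then show ?thesis using Dn by (simp add: power_divide powr_half_sqrt)
  qed
  have key: "sqrt (min D n') / 4 \<le> n'\<^sup>2 * r\<^sup>2 / (2 * (n' + D))"
  proof (cases "D \<le> n'")
    case True
    have "(D powr (1/4) / n' powr (1/2))\<^sup>2 \<le> r\<^sup>2" unfolding r_def by (intro power_mono) auto
    then have "n'\<^sup>2 * (sqrt D / n') \<le> n'\<^sup>2 * r\<^sup>2" unfolding sq2 by (intro mult_left_mono) auto
    moreover have "n'\<^sup>2 * (sqrt D / n') = n' * sqrt D" using Dn by (simp add: power2_eq_square)
    moreover have "sqrt D * (2 * (n' + D)) \<le> sqrt D * (4 * n')" using True Dn by (intro mult_left_mono) auto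
    ultimately have "sqrt D / 4 * (2 * (n' + D)) \<le> n'\<^sup>2 * r\<^sup>2" by (simp add: mult_ac)
    then show ?thesis using True Dn by (simp add: min_def le_divide_eq)
  next
    case False
    have "(D powr (1/2) / n' powr (3/4))\<^sup>2 \<le> r\<^sup>2" unfolding r_def by (intro power_mono) auto
    then have "n'\<^sup>2 * (D / (n' * sqrt n')) \<le> n'\<^sup>2 * r\<^sup>2" unfolding sq1 by (intro mult_left_mono) auto
    moreover have "n'\<^sup>2 * (D / (n' * sqrt n')) = D * (n' / sqrt n')"
      using Dn by (simp add: power2_eq_square)
    moreover have "n' / sqrt n' = sqrt n'" using Dn by (intro real_div_sqrt) simp
    moreover have "sqrt n' * (2 * (n' + D)) \<le> sqrt n' * (4 * D)" using False Dn by (intro mult_left_mono) auto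
    ultimately have "sqrt n' / 4 * (2 * (n' + D)) \<le> n'\<^sup>2 * r\<^sup>2"
      by (simp only:) (simp add: mult_ac)
    then show ?thesis using False Dn by (simp add: min_def le_divide_eq)
  qed
  have "2500 * L * sqrt (min D n') / \<beta>\<^sup>2 = 10000 * L / \<beta>\<^sup>2 * (sqrt (min D n') / 4)" by simp
  also have "\<dots> \<le> 10000 * L / \<beta>\<^sup>2 * (n'\<^sup>2 * r\<^sup>2 / (2 * (n' + D)))"
    using L by (intro mult_left_mono key) auto
  also have "\<dots> = (n' * (100 / \<beta> * sqrt L * r))\<^sup>2 / (2 * (n' + D))"
    using L by (simp add: power_mult_distrib power_divide)
  also have "\<dots> \<le> (n' * (\<Sum>k=1..d. \<bar>p k - q k\<bar>))\<^sup>2 / (2 * (n' + D))"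
  proof (intro divide_right_mono power_mono mult_left_mono)
    show "100 / \<beta> * sqrt L * r \<le> (\<Sum>k=1..d. \<bar>p k - q k\<bar>)"
      using \<epsilon> sep by (simp add: r_def D_def n'_def)
  qed (use Dn r0 L \<beta> in auto)
  also have "\<dots> \<le> Mu" using Mu_ge by (simp add: n'_def D_def)
  finally show ?thesis by (simp add: D_def n'_def min_def split: if_splits)
qed

end

section \<open>Exchangeability and the pooled sample\<close>

text \<open>Inside \<open>A\<close> the product of masses is reindexed along the bijection. The
  assumption on outside points keeps the default value there after composing with
  \<open>h\<close>.\<close>

lemma Pi_pmf_reindex:
  assumes A: "finite A" and h: "bij_betw h A B" and out: "\<And>x. x \<notin> A \<Longrightarrow> h x \<notin> B"
  shows "map_pmf (\<lambda>g. g \<circ> h) (Pi_pmf B dflt p) = Pi_pmf A dflt (\<lambda>x. p (h x))"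
proof -
  have B: "finite B" using A h bij_betw_finite by blast
  have hA: "h x \<in> B \<longleftrightarrow> x \<in> A" for x using h out by (auto simp: bij_betw_def)
  define h' where "h' = the_inv_into A h"
  have h'h: "h' (h x) = x" if "x \<in> A" for x
    using that h by (simp add: h'_def the_inv_into_f_f bij_betw_def)
  have hh': "h (h' y) = y" and h'A: "h' y \<in> A" if "y \<in> B" for y
    using that h bij_betwE[OF bij_betw_the_inv_into[OF h]] by (auto simp: h'_def f_the_inv_into_f_bij_betw)
  show ?thesis
  proof (rule pmf_eqI)
    fix g
    show "pmf (map_pmf (\<lambda>g. g \<circ> h) (Pi_pmf B dflt p)) g = pmf (Pi_pmf A dflt (\<lambda>x. p (h x))) g"
    proof (cases "\<forall>x. x \<notin> A \<longrightarrow> g x = dflt")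
      case True
      \<comment> \<open>The only preimage of \<open>g\<close> that is \<open>dflt\<close> outside
        \<open>B\<close>; all others have mass 0, so the event collapses to this point.\<close>
      define g' where "g' y = (if y \<in> B then g (h' y) else dflt)" for y
      have g: "g = g' \<circ> h" using True hA h'h by (auto simp: g'_def fun_eq_iff)
      have "pmf (map_pmf (\<lambda>g. g \<circ> h) (Pi_pmf B dflt p)) g
        = measure_pmf.prob (Pi_pmf B dflt p) {f. f \<circ> h = g}"
        by (simp add: pmf_map vimage_def)
      also have "\<dots> = measure_pmf.prob (Pi_pmf B dflt p) {g'}"
      proof (rule measure_prob_cong_0)
        fix f assume f: "f \<in> {f. f \<circ> h = g} - {g'}"
        have "\<exists>y. y \<notin> B \<and> f y \<noteq> dflt"
        proof (rule ccontr)
          assume "\<not> ?thesis"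
          then have out: "f y = dflt" if "y \<notin> B" for y using that by blast
          have gf: "g x = f (h x)" for x using f by auto
          have "f y = g' y" for y
            using out[of y] hh'[of y] by (cases "y \<in> B") (simp_all add: g'_def gf)
          then have "f = g'" by (rule ext)
          then show False using f by simp
        qed
        then show "pmf (Pi_pmf B dflt p) f = 0" by (rule pmf_Pi_outside[OF B])
      qed (use g in auto)
      also have "\<dots> = (\<Prod>y\<in>B. pmf (p y) (g' y))"
        by (simp add: measure_pmf_single pmf_Pi[OF B] g'_def)
      also have "\<dots> = (\<Prod>x\<in>A. pmf (p (h x)) (g' (h x)))"
        by (rule prod.reindex_bij_betw[OF h, symmetric])
      also have "\<dots> = pmf (Pi_pmf A dflt (\<lambda>x. p (h x))) g"
        using True by (simp add: pmf_Pi[OF A] g)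
      finally show ?thesis .
    next
      case False
      then obtain x where x: "x \<notin> A" "g x \<noteq> dflt" by blast
      have "g \<notin> set_pmf (map_pmf (\<lambda>g. g \<circ> h) (Pi_pmf B dflt p))"
      proof
        assume "g \<in> set_pmf (map_pmf (\<lambda>g. g \<circ> h) (Pi_pmf B dflt p))"
        then obtain f where "f \<in> set_pmf (Pi_pmf B dflt p)" "g = f \<circ> h" by auto
        then show False using x hA[of x] set_Pi_pmf_subset[OF B, of dflt p] by auto
      qed
      then have "pmf (map_pmf (\<lambda>g. g \<circ> h) (Pi_pmf B dflt p)) g = 0" by (simp only: set_pmf_iff not_not)
      moreover have "pmf (Pi_pmf A dflt (\<lambda>x. p (h x))) g = 0" using x by (intro pmf_Pi_outside[OF A]) blast
      ultimately show ?thesis by simp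
    qed
  qed
qed

section \<open>Level of the test under exchangeability\<close>

lemma perm_stat_relabel:
  assumes \<sigma>: "\<sigma> permutes {1..2*n}"
  shows "perm_stat n d (X \<circ> map_prod \<sigma> id) \<pi> = perm_stat n d X (\<sigma> \<circ> \<pi>)"
proof -
  have "col_sum n (X \<circ> map_prod \<sigma> id) k = col_sum n X k" for k
    unfolding col_sum_def using sum.permute[OF \<sigma>, of "\<lambda>i. real (X (i, k))"] by (simp add: o_def)
  then show ?thesis by (simp add: perm_stat_def)
qed

text \<open>Relabelling the rows turns into left composition with \<sigma>, which merely reorders
  the sum over all permutations.\<close>

lemma crit_value_relabel:
  assumes \<sigma>: "\<sigma> permutes {1..2*n}"
  shows "crit_value n d \<alpha> (X \<circ> map_prod \<sigma> id) = crit_value n d \<alpha> X"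
  unfolding crit_value_def perm_stat_relabel[OF \<sigma>]
  by (simp only: setum_permutations_compose_left[OF \<sigma>, of "\<lambda>\<pi>. of_bool (perm_stat n d X \<pi> \<le> t)" for t, symmetric])

text \<open>Exceedance at \<sigma> is exceedance at the identity for the relabelled sample, with the
  same critical value, so it has the same probability for every \<sigma>. Averaging over \<sigma>
  leaves a count of permutations that is bounded for each fixed sample.\<close>

lemma exchangeable_level:
  assumes ex: "\<And>\<sigma>. \<sigma> permutes {1..2*n} \<Longrightarrow> map_pmf (\<lambda>X. X \<circ> map_prod \<sigma> id) P = P"
    and \<alpha>: "0 \<le> \<alpha>" "\<alpha> < 1"
  shows "measure_pmf.prob P {X. perm_stat n d X id > crit_value n d \<alpha> X} \<le> \<alpha>"
proof -
  define S where "S = {\<pi>. \<pi> permutes {1..2*n}}"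
  define u where "u \<pi> X = (of_bool (perm_stat n d X \<pi> > crit_value n d \<alpha> X) :: real)" for \<pi> X
  have iu: "integrable (measure_pmf P) (u \<pi>)" for \<pi>
    by (intro measure_pmf.integrable_const_bound[where B = 1]) (auto simp: u_def)
  define \<rho> where "\<rho> = measure_pmf.prob P {X. perm_stat n d X id > crit_value n d \<alpha> X}"
  have eq: "measure_pmf.expectation P (u \<sigma>) = \<rho>" if "\<sigma> \<in> S" for \<sigma>
  proof -
    have \<sigma>: "\<sigma> permutes {1..2*n}" using that by (simp add: S_def)
    have "u \<sigma> = (\<lambda>X. u id (X \<circ> map_prod \<sigma> id))"
      by (rule ext) (simp add: u_def perm_stat_relabel[OF \<sigma>] crit_value_relabel[OF \<sigma>])
    then have "measure_pmf.expectation P (u \<sigma>) = measure_pmf.expectation (map_pmf (\<lambda>X. X \<circ> map_prod \<sigma> id) P) (u id)"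
      by simp
    also have "\<dots> = measure_pmf.expectation P (u id)" by (simp only: ex[OF \<sigma>])
    also have "u id = indicator {X. perm_stat n d X id > crit_value n d \<alpha> X}"
      by (auto simp: u_def fun_eq_iff indicator_def)
    finally show ?thesis by (simp add: \<rho>_def)
  qed
  have "fact (2*n) * \<rho> = (\<Sum>\<sigma>\<in>S. measure_pmf.expectation P (u \<sigma>))"
    using eq by (simp add: S_def card_permutations[OF refl])
  also have "\<dots> = measure_pmf.expectation P (\<lambda>X. \<Sum>\<sigma>\<in>S. u \<sigma> X)"
    by (rule Bochner_Integration.integral_sum[symmetric]) (rule iu)
  also have "\<dots> \<le> \<alpha> * fact (2*n)"
    using crit_value_exceed_le[OF \<alpha>, of n d] unfolding u_def S_def
    by (intro measure_pmf.integral_le_const Bochner_Integration.integrable_sum iu[unfolded u_def]) auto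
  finally show ?thesis unfolding \<rho>_def by (simp add: mult.commute)
qed

section \<open>From the two samples to the pooled sample\<close>

lemma pooled_poisson_model:
  "map_pmf (\<lambda>(Y, Z). pooled n Y Z) (poisson_model n d P)
    = Pi_pmf ({1..2*n} \<times> {1..d}) 0 (\<lambda>(i, k). poisson (if i \<le> n then pmf (fst P) k else pmf (snd P) k))"
proof -
  define A where "A = {1..n} \<times> {1..d}"
  define B where "B = {n+1..2*n} \<times> {1..d}"
  define r where "r = (\<lambda>(i, k). poisson (if i \<le> n then pmf (fst P) k else pmf (snd P) k))"
  \<comment> \<open>Truncated subtraction sends rows \<open>i \<le> n\<close> to row 0, outside
    \<open>{1..n}\<close>, so points outside \<open>B\<close> land outside \<open>A\<close>, as
    reindexing requires.\<close>
  define h where "h = (\<lambda>(i::nat, k::nat). (i - n, k))"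
  have fin: "finite A" "finite B" "A \<inter> B = {}" and un: "{1..2*n} \<times> {1..d} = A \<union> B"
    by (auto simp: A_def B_def)
  have Y: "poisson_sample n d (fst P) = Pi_pmf A 0 r"
    unfolding poisson_sample_def A_def r_def by (intro Pi_pmf_cong) auto
  have hB: "bij_betw h B A"
    by (rule bij_betw_byWitness[where f' = "\<lambda>(i, k). (i + n, k)"]) (auto simp: A_def B_def h_def)
  have "map_pmf (\<lambda>g. g \<circ> h) (poisson_sample n d (snd P)) = Pi_pmf B 0 (\<lambda>x. case h x of (i, k) \<Rightarrow> poisson (pmf (snd P) k))"
    unfolding poisson_sample_def A_def[symmetric]
    by (rule Pi_pmf_reindex[OF fin(2) hB]) (auto simp: A_def B_def h_def)
  also have "\<dots> = Pi_pmf B 0 r" by (intro Pi_pmf_cong) (auto simp: B_def r_def h_def)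
  finally have Z: "Pi_pmf B 0 r = map_pmf (\<lambda>g. g \<circ> h) (poisson_sample n d (snd P))" ..
  have "Pi_pmf (A \<union> B) 0 r = map_pmf (\<lambda>(f, g) x. if x \<in> A then f x else g x)
      (pair_pmf (poisson_sample n d (fst P)) (map_pmf (\<lambda>g. g \<circ> h) (poisson_sample n d (snd P))))"
    unfolding Y Z[symmetric] by (rule Pi_pmf_union[OF fin])
  also have "\<dots> = map_pmf (\<lambda>(f, g) x. if x \<in> A then f x else g (h x)) (poisson_model n d P)"
    unfolding poisson_model_def pair_map_pmf2 by (simp add: pmf.map_comp o_def case_prod_unfold cong: if_cong)
  also have "\<dots> = map_pmf (\<lambda>(Y, Z). pooled n Y Z) (poisson_model n d P)"
  \<comment> \<open>Off the grid with \<open>i \<le> n\<close>, \<open>pooled\<close> reads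
    \<open>Y\<close> whereas the union reads \<open>Z\<close> at row 0; both are the default 0 on
    the support.\<close>
  proof (rule map_pmf_cong[OF refl], clarify, rule ext, clarify)
    fix Y Z i k assume "(Y, Z) \<in> set_pmf (poisson_model n d P)"
    then have "Y \<in> set_pmf (Pi_pmf A 0 r)" "Z \<in> set_pmf (poisson_sample n d (snd P))"
      unfolding poisson_model_def Y by auto
    then have "\<forall>x. x \<notin> A \<longrightarrow> Y x = 0" "\<forall>x. x \<notin> A \<longrightarrow> Z x = 0"
      using subsetD[OF set_Pi_pmf_subset[OF fin(1)]] unfolding poisson_sample_def A_def[symmetric]
      by (simp_all only: mem_Collect_eq)
    then show "(if (i, k) \<in> A then Y (i, k) else Z (h (i, k))) = pooled n Y Z (i, k)"
      by (auto simp: pooled_def h_def A_def)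
  qed
  finally show ?thesis unfolding un r_def ..
qed

lemma cell_count_pooled:
  "(\<Sum>i=1..n. real (pooled n Y Z (i, k))) = cell_count n Y k"
  "(\<Sum>i=1..n. real (pooled n Y Z (i + n, k))) = cell_count n Z k"
  unfolding cell_count_def by (auto simp: pooled_def intro!: sum.cong)

lemma col_sum_pooled: "col_sum n (pooled n Y Z) k = cell_count n Y k + cell_count n Z k"
  unfolding col_sum_def sum_double by (simp only: sum.distrib cell_count_pooled)

lemma perm_chi2_stat_pooled: "perm_chi2_stat n d Y Z \<pi> = perm_stat n d (pooled n Y Z) \<pi>"
proof -
  have "x / (cell_count n Y k + cell_count n Z k) * of_bool (0 < cell_count n Y k + cell_count n Z k)
      = x / (cell_count n Y k + cell_count n Z k)" for x k
  proof -
    have "0 \<le> cell_count n Y k + cell_count n Z k"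
      unfolding cell_count_def by (intro add_nonneg_nonneg sum_nonneg) auto
    then show ?thesis by (cases "cell_count n Y k + cell_count n Z k = 0") auto
  qed
  then show ?thesis
    unfolding perm_chi2_stat_def perm_stat_def Let_def col_sum_pooled sum_subtractf diff_diff_add by (simp only:)
qed

lemma chi2_stat_pooled: "chi2_stat n d Y Z = perm_stat n d (pooled n Y Z) id"
  unfolding perm_chi2_stat_pooled[symmetric] perm_chi2_stat_def chi2_stat_def Let_def id_apply cell_count_pooled ..

lemma perm_critical_value_pooled: "perm_critical_value n d \<alpha> Y Z = crit_value n d \<alpha> (pooled n Y Z)"
  unfolding perm_critical_value_def crit_value_def perm_chi2_stat_pooled ..

lemma two_sample_pmf:
  assumes "n \<ge> 1" "d \<ge> 1" "pY \<in> distributions d" "pZ \<in> distributions d"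
  shows "two_sample n d (pmf pY) (pmf pZ)"
  using assms by unfold_locales (auto simp: distributions_def intro!: sum_pmf_eq_1)

lemma emeasure_poisson_model:
  assumes "two_sample n d (pmf pY) (pmf pZ)"
  shows "emeasure (poisson_model n d (pY, pZ)) {(Y, Z). Q (pooled n Y Z)}
    = ennreal (measure_pmf.prob (poisson_field.F (two_sample.cells n d) (two_sample.rate n (pmf pY) (pmf pZ))) {X. Q X})"
proof -
  interpret two_sample n d "pmf pY" "pmf pZ" by fact
  have F: "F = map_pmf (\<lambda>(Y, Z). pooled n Y Z) (poisson_model n d (pY, pZ))"
    unfolding pooled_poisson_model F_def by (intro Pi_pmf_cong) (auto simp: cells_def rate_def)
  have "(\<lambda>(Y, Z). pooled n Y Z) -` {X. Q X} = {(Y, Z). Q (pooled n Y Z)}" by auto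
  then show ?thesis unfolding F by (simp add: measure_pmf.emeasure_eq_measure)
qed

text \<open>For equal distributions \<open>rate\<close> ignores the row, and a row permutation maps
  the grid of cells onto itself.\<close>

lemma null_exchangeable:
  assumes "two_sample n d p p" and \<sigma>: "\<sigma> permutes {1..2*n}"
  shows "map_pmf (\<lambda>X. X \<circ> map_prod \<sigma> id) (poisson_field.F (two_sample.cells n d) (two_sample.rate n p p))
    = poisson_field.F (two_sample.cells n d) (two_sample.rate n p p)"
proof -
  interpret two_sample n d p p by fact
  have b: "bij_betw (map_prod \<sigma> id) cells cells"
    unfolding cells_def by (intro bij_betw_map_prod permutes_imp_bij[OF \<sigma>]) auto
  have mem: "map_prod \<sigma> id x \<in> cells \<longleftrightarrow> x \<in> cells" for x
    unfolding cells_def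
    by (cases x) (simp only: map_prod_simp mem_Times_iff fst_conv snd_conv id_apply permutes_in_image[OF \<sigma>])
  have "map_pmf (\<lambda>X. X \<circ> map_prod \<sigma> id) F = Pi_pmf cells 0 (\<lambda>x. poisson (rate (map_prod \<sigma> id x)))"
    unfolding F_def by (rule Pi_pmf_reindex[OF fin b]) (simp only: mem simp_thms)
  also have "\<dots> = F" unfolding F_def by (intro Pi_pmf_cong) (auto simp: rate_def)
  finally show ?thesis .
qed

theorem theorem8p1:
  shows "\<exists>C::real. C > 0 \<and>
    (\<forall>(n::nat) (d::nat) (\<alpha>::real) (\<beta>::real) (\<epsilon>::real).
      n \<ge> 1 \<longrightarrow> d \<ge> 1 \<longrightarrow>
      0 < \<alpha> \<longrightarrow> \<alpha> < exp (-1) \<longrightarrow>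
      0 < \<beta> \<longrightarrow> \<beta> < 1 - \<alpha> \<longrightarrow>
      \<epsilon> \<ge> C / \<beta> * sqrt (ln (1 / \<alpha>)) *
            max (real d powr (1/2) / real n powr (3/4)) (real d powr (1/4) / real n powr (1/2)) \<longrightarrow>
      (SUP P\<in>null_class d. emeasure (poisson_model n d P)
          {(Y, Z). chi2_stat n d Y Z > perm_critical_value n d \<alpha> Y Z}) \<le> ennreal \<alpha> \<and>
      (SUP P\<in>alt_class d \<epsilon>. emeasure (poisson_model n d P)
          {(Y, Z). chi2_stat n d Y Z \<le> perm_critical_value n d \<alpha> Y Z}) \<le> ennreal \<beta>)"
proof (intro exI[of _ 100] conjI allI impI SUP_least)
  fix n d :: nat and \<alpha> \<beta> \<epsilon> :: real and P :: "nat pmf \<times> nat pmf"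
  assume nd: "n \<ge> 1" "d \<ge> 1" and \<alpha>: "0 < \<alpha>" "\<alpha> < exp (-1)" and \<beta>: "0 < \<beta>" "\<beta> < 1 - \<alpha>"
    and \<epsilon>: "100 / \<beta> * sqrt (ln (1 / \<alpha>)) *
            max (real d powr (1/2) / real n powr (3/4)) (real d powr (1/4) / real n powr (1/2)) \<le> \<epsilon>"
  have \<alpha>1: "\<alpha> < 1" using \<beta> by linarith
  obtain pY pZ where P: "P = (pY, pZ)" by (cases P)
  {
    assume "P \<in> null_class d"
    then have eq: "pZ = pY" and dist: "pY \<in> distributions d" unfolding P null_class_def by auto
    have ts: "two_sample n d (pmf pY) (pmf pY)" by (rule two_sample_pmf[OF nd dist dist])
    show "emeasure (poisson_model n d P) {(Y, Z). chi2_stat n d Y Z > perm_critical_value n d \<alpha> Y Z} \<le> ennreal \<alpha>"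
      unfolding P eq chi2_stat_pooled perm_critical_value_pooled
        emeasure_poisson_model[OF ts, of "\<lambda>X. crit_value n d \<alpha> X < perm_stat n d X id"]
      using \<alpha> \<alpha>1 by (intro ennreal_leI exchangeable_level null_exchangeable[OF ts]) auto
  next
    assume "P \<in> alt_class d \<epsilon>"
    then have dist: "pY \<in> distributions d" "pZ \<in> distributions d"
      and sep: "\<epsilon> \<le> (\<Sum>k=1..d. \<bar>pmf pY k - pmf pZ k\<bar>)"
      unfolding P alt_class_def l1_distance_def by auto
    have ts: "two_sample n d (pmf pY) (pmf pZ)" by (rule two_sample_pmf[OF nd dist])
    have "1 \<le> 1 / \<alpha>" using \<alpha> \<alpha>1 by simp
    then have L: "0 \<le> ln (1 / \<alpha>)" by (rule ln_ge_zero)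
    have \<beta>1: "\<beta> < 1" using \<alpha> \<beta> by linarith
    show "emeasure (poisson_model n d P) {(Y, Z). chi2_stat n d Y Z \<le> perm_critical_value n d \<alpha> Y Z} \<le> ennreal \<beta>"
      unfolding P chi2_stat_pooled perm_critical_value_pooled
        emeasure_poisson_model[OF ts, of "\<lambda>X. perm_stat n d X id \<le> crit_value n d \<alpha> X"]
      by (intro ennreal_leI two_sample.power_bound[OF ts \<alpha> \<beta>(1) \<beta>1]
          two_sample.Mu_large[OF ts L \<beta>(1) \<epsilon> sep])
  }
qed simp

end
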